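(* Let $\mathbb F\in\{\mathbb R,\mathbb C\}$ and let $A,B,C\in \mathbf{Gr}_{n,k}(\mathbb F)$ be three points lying in a metric ball $\mathcal B\subset \mathbf{Gr}_{n,k}(\mathbb F)$ of radius less than $\rho_{\mathbb F}$. (1) (Semi-Parallelogram Law) If $M$ is the midpoint of the geodesic from $A$ to $B$, i.e. $M=A\sharp B$, then $$d^2(M,C)\ \ge\ \frac{d^2(A,C)+d^2(B,C)}{2}-\frac{d^2(A,B)}{4}.$$ (2) (Law of Cosines) Suppose that $A,B,C$ are distinct, and let $\alpha,\beta,\gamma$ be the angles at $A,B,C$, respectively, of the geodesic triangle with vertices $A,B,C$. Then $$d^2(B,A)\ \le\ d^2(C,A)+d^2(C,B)-2\,d(C,A)\,d(C,B)\cos\gamma$$ and $$d(B,A)\ \ge\ d(C,A)\cos\alpha+d(C,B)\cos\beta.$$ Moreover, $$\alpha+\beta+\gamma\ \ge\ \pi.$$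
   Context: For $\mathbb F=\mathbb C$, $\mathbf{Gr}_{n,k}(\mathbb C)=\{P\in\mathbb C^{n\times n}: P^2=P,\ P^*=P,\ \operatorname{rank}P=k\}$, a compact submanifold of the real vector space of $n\times n$ Hermitian matrices; for $\mathbb F=\mathbb R$, $\mathbf{Gr}_{n,k}(\mathbb R)=\{P\in\mathbb R^{n\times n}: P^2=P,\ P^\top=P,\ \operatorname{rank}P=k\}$, a compact submanifold of the space of real symmetric $n\times n$ matrices. It carries the Riemannian metric induced by the Frobenius inner product, $\langle X,Y\rangle_P=\operatorname{tr}(XY)$ for $X,Y\in T_P\mathbf{Gr}_{n,k}(\mathbb F)$. $d$ denotes the Riemannian distance and $\mathrm{Exp}_P$ the Riemannian exponential map at $P$. Let $R_P$ be the injectivity radius at $P$ (the largest $R>0$ such that $\mathrm{Exp}_P$ is a diffeomorphism from the open ball of radius $R$ about $0$ in $T_P\mathbf{Gr}_{n,k}(\mathbb F)$ onto its image), $r_{\mathbb F}=\min_P R_P>0$, and let $\delta_{\mathbb F}$ be the maximum of the sectional curvatures of $\mathbf{Gr}_{n,k}(\mathbb F)$. Put $$\rho_{\mathbb F}=\min\left\{\frac{r_{\mathbb F}}{2},\ \frac{\pi}{2\,\delta_{\mathbb F}^{1/2}}\right\}.$$ Convention: the second term is $+\infty$ if the manifold has no tangent 2-planes (dimension at most 1), and $R_P=+\infty$ if the manifold is a single point. It is known that every metric ball $\mathcal B$ of radius less than $\rho_{\mathbb F}$ is strongly convex: for any $P,Q\in\mathcal B$ there is a unique minimizing geodesic from $P$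 to $Q$ in $\mathbf{Gr}_{n,k}(\mathbb F)$, and it lies entirely in $\mathcal B$. For $P,Q\in\mathcal B$, $\overrightarrow{PQ}=\mathrm{Exp}_P^{-1}Q\in T_P\mathbf{Gr}_{n,k}(\mathbb F)$ denotes the initial tangent vector of this geodesic (the unique vector of norm less than $r_{\mathbb F}$ with $\mathrm{Exp}_P(\overrightarrow{PQ})=Q$). For $t\in[0,1]$, $P\sharp_tQ=\mathrm{Exp}_P(t\,\overrightarrow{PQ})$ and $P\sharp Q=P\sharp_{1/2}Q$ (the midpoint of the geodesic from $P$ to $Q$). The geodesic triangle with distinct vertices $A,B,C\in\mathcal B$ has as sides the minimizing geodesics joining its vertices. Its angle at a vertex is the angle in $[0,\pi]$ between the initial tangent vectors of the two sides issuing from that vertex; e.g. $\gamma$ at $C$ is the angle between $\overrightarrow{CA}$ and $\overrightarrow{CB}$ with respect to $\langle\cdot,\cdot\rangle_C$. *)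

theory Defs
  imports "HOL-Analysis.Analysis"
begin

section \<open>The scalar fields\<close>

text \<open>
  The class covers exactly the two cases \<open>real\<close> (with trivial conjugation) and \<open>complex\<close>:
  both are instances, and a finite-dimensional commutative normed division algebra over the reals
  is isometrically isomorphic to one of them.
\<close>

class real_or_complex = real_normed_field + euclidean_space +
  fixes cconj :: "'a \<Rightarrow> 'a"
  assumes conj_add: "cconj (x + y) = cconj x + cconj y"
    and conj_mult: "cconj (x * y) = cconj x * cconj y"
    and conj_conj: "cconj (cconj x) = x"
    and mult_conj: "x * cconj x = (norm x)\<^sup>2 *\<^sub>R 1"

instantiation real :: real_or_complex
begin
definition cconj_real :: "real \<Rightarrow> real" where "cconj_real x = x"
instance by standard (simp_all add: cconj_real_def power2_eq_square)
end

instantiation complex :: real_or_complex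
begin
definition cconj_complex :: "complex \<Rightarrow> complex" where "cconj_complex x = cnj x"
instance by standard (simp_all add: cconj_complex_def scaleR_conv_of_real flip: complex_norm_square)
end

section \<open>Smooth maps between subsets of Euclidean spaces\<close>

text \<open>\<open>Ck_on m U f\<close>: for open \<open>U\<close>, \<open>f\<close> has continuous derivatives of order up to \<open>m\<close> on \<open>U\<close>.\<close>

primrec Ck_on :: "nat \<Rightarrow> 'a::euclidean_space set \<Rightarrow> ('a \<Rightarrow> 'b::euclidean_space) \<Rightarrow> bool" where
  "Ck_on 0 U f \<longleftrightarrow> continuous_on U f"
| "Ck_on (Suc m) U f \<longleftrightarrow>
     (\<exists>f'. (\<forall>x\<in>U. (f has_derivative f' x) (at x)) \<and> (\<forall>v. Ck_on m U (\<lambda>x. f' x v)))"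

text \<open>A map on an arbitrary subset is smooth if it has smooth local extensions to open sets.\<close>

definition smooth_on :: "'a::euclidean_space set \<Rightarrow> ('a \<Rightarrow> 'b::euclidean_space) \<Rightarrow> bool" where
  "smooth_on X f \<longleftrightarrow>
     (\<forall>x\<in>X. \<exists>U F. open U \<and> x \<in> U \<and> (\<forall>m. Ck_on m U F) \<and> (\<forall>y\<in>U \<inter> X. F y = f y))"

definition diffeo_onto_image :: "'a::euclidean_space set \<Rightarrow> ('a \<Rightarrow> 'b::euclidean_space) \<Rightarrow> bool" where
  "diffeo_onto_image X f \<longleftrightarrow> smooth_on X f \<and> inj_on f X \<and> smooth_on (f ` X) (the_inv_into X f)"

section \<open>Riemannian geometry of a submanifold of a Euclidean space\<close>

text \<open>
  Throughout, \<open>M\<close> is meant to be a compact connected smooth embedded submanifold, with the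
  Riemannian metric induced by the ambient inner product.
\<close>

definition curve_with_velocity ::
    "'a::euclidean_space set \<Rightarrow> 'a \<Rightarrow> 'a \<Rightarrow> (real \<Rightarrow> 'a) \<Rightarrow> bool" where
  "curve_with_velocity M P v c \<longleftrightarrow>
     (\<exists>e>0. smooth_on {-e<..<e} c \<and> c ` {-e<..<e} \<subseteq> M) \<and>
     c 0 = P \<and> (c has_vector_derivative v) (at 0)"

definition tangent_space :: "'a::euclidean_space set \<Rightarrow> 'a \<Rightarrow> 'a set" where
  "tangent_space M P = {v. \<exists>c. curve_with_velocity M P v c}"

definition tangent_proj :: "'a::euclidean_space set \<Rightarrow> 'a \<Rightarrow> 'a \<Rightarrow> 'a" where
  "tangent_proj M P w =
     (THE u. u \<in> tangent_space M P \<and> (\<forall>v\<in>tangent_space M P. (w - u) \<bullet> v = 0))"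

subsection \<open>Distance\<close>

text \<open>
  The library's piecewise \<open>C\<^sup>1\<close> curves may have unbounded speed near the exceptional points, and
  \<open>integral\<close> is 0 for non-integrable functions; hence the integrability (finite length) condition.
\<close>

definition admissible_path :: "'a::euclidean_space set \<Rightarrow> 'a \<Rightarrow> 'a \<Rightarrow> (real \<Rightarrow> 'a) \<Rightarrow> bool" where
  "admissible_path M P Q c \<longleftrightarrow>
     c piecewise_C1_differentiable_on {0..1} \<and>
     (\<lambda>t. norm (vector_derivative c (at t))) integrable_on {0..1} \<and>
     path_image c \<subseteq> M \<and> pathstart c = P \<and> pathfinish c = Q"

definition curve_length :: "(real \<Rightarrow> 'a::euclidean_space) \<Rightarrow> real" where
  "curve_length c = integral {0..1} (\<lambda>t. norm (vector_derivative c (at t)))"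

definition rdist :: "'a::euclidean_space set \<Rightarrow> 'a \<Rightarrow> 'a \<Rightarrow> real" where
  "rdist M P Q = Inf {curve_length c | c. admissible_path M P Q c}"

definition metric_ball :: "'a::euclidean_space set \<Rightarrow> 'a \<Rightarrow> real \<Rightarrow> 'a set" where
  "metric_ball M Z s = {Q \<in> M. rdist M Z Q < s}"

subsection \<open>Geodesics and the exponential map\<close>

text \<open>
  The Levi-Civita connection of the induced metric is the tangential part of the ambient
  derivative, so the geodesic equation says that the tangential part of the acceleration vanishes.
  By completeness of \<open>M\<close>, geodesics may be taken to be defined on all of the real line.
\<close>

definition geodesic :: "'a::euclidean_space set \<Rightarrow> (real \<Rightarrow> 'a) \<Rightarrow> bool" where
  "geodesic M g \<longleftrightarrow> smooth_on UNIV g \<and> range g \<subseteq> M \<and>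
     (\<forall>t. tangent_proj M (g t)
        (vector_derivative (\<lambda>s. vector_derivative g (at s)) (at t)) = 0)"

definition Exp :: "'a::euclidean_space set \<Rightarrow> 'a \<Rightarrow> 'a \<Rightarrow> 'a" where
  "Exp M P v =
     (THE Q. \<exists>g. geodesic M g \<and> g 0 = P \<and> (g has_vector_derivative v) (at 0) \<and> g 1 = Q)"

definition injectivity_radius_at :: "'a::euclidean_space set \<Rightarrow> 'a \<Rightarrow> ereal" where
  "injectivity_radius_at M P =
     Sup {ereal R | R. R > 0 \<and> diffeo_onto_image {v \<in> tangent_space M P. norm v < R} (Exp M P)}"

definition injectivity_radius :: "'a::euclidean_space set \<Rightarrow> ereal" where
  "injectivity_radius M = (INF P\<in>M. injectivity_radius_at M P)"

subsection \<open>Sectional curvature\<close>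

text \<open>The derivative at \<open>P\<close> in direction \<open>v\<close> of a function that only matters on \<open>M\<close>.\<close>

definition dir_deriv ::
    "'a::euclidean_space set \<Rightarrow> ('a \<Rightarrow> 'a) \<Rightarrow> 'a \<Rightarrow> 'a \<Rightarrow> 'a" where
  "dir_deriv M F P v =
     (THE w. \<forall>c. curve_with_velocity M P v c \<longrightarrow> ((F \<circ> c) has_vector_derivative w) (at 0))"

definition vector_field :: "'a::euclidean_space set \<Rightarrow> ('a \<Rightarrow> 'a) \<Rightarrow> bool" where
  "vector_field M X \<longleftrightarrow> smooth_on M X \<and> (\<forall>P\<in>M. X P \<in> tangent_space M P)"

text \<open>\<open>cov_deriv M X Y\<close> is \<open>\<nabla>\<close> of \<open>Y\<close> along \<open>X\<close>, for the Levi-Civita connection.\<close>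

definition cov_deriv ::
    "'a::euclidean_space set \<Rightarrow> ('a \<Rightarrow> 'a) \<Rightarrow> ('a \<Rightarrow> 'a) \<Rightarrow> 'a \<Rightarrow> 'a" where
  "cov_deriv M X Y = (\<lambda>P. tangent_proj M P (dir_deriv M Y P (X P)))"

definition lie_bracket ::
    "'a::euclidean_space set \<Rightarrow> ('a \<Rightarrow> 'a) \<Rightarrow> ('a \<Rightarrow> 'a) \<Rightarrow> 'a \<Rightarrow> 'a" where
  "lie_bracket M X Y = (\<lambda>P. dir_deriv M Y P (X P) - dir_deriv M X P (Y P))"

text \<open>The curvature tensor \<open>R(x,y)z\<close> at \<open>P\<close>; the value does not depend on the chosen fields.\<close>

definition curvature_tensor :: "'a::euclidean_space set \<Rightarrow> 'a \<Rightarrow> 'a \<Rightarrow> 'a \<Rightarrow> 'a \<Rightarrow> 'a" where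
  "curvature_tensor M P x y z =
     (THE w. \<forall>X Y Z. vector_field M X \<and> vector_field M Y \<and> vector_field M Z \<and>
        X P = x \<and> Y P = y \<and> Z P = z \<longrightarrow>
        w = cov_deriv M X (cov_deriv M Y Z) P - cov_deriv M Y (cov_deriv M X Z) P
            - cov_deriv M (lie_bracket M X Y) Z P)"

definition sectional_curvature :: "'a::euclidean_space set \<Rightarrow> 'a \<Rightarrow> 'a \<Rightarrow> 'a \<Rightarrow> real" where
  "sectional_curvature M P x y =
     (curvature_tensor M P x y y \<bullet> x) / ((x \<bullet> x) * (y \<bullet> y) - (x \<bullet> y)\<^sup>2)"

definition sectional_curvatures :: "'a::euclidean_space set \<Rightarrow> real set" where
  "sectional_curvatures M =
     {sectional_curvature M P x y | P x y.
        P \<in> M \<and> x \<in> tangent_space M P \<and> y \<in> tangent_space M P \<and> x \<noteq> y \<and> independent {x, y}}"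

text \<open>The set of curvatures is empty exactly when there are no tangent 2-planes.\<close>

definition convexity_bound :: "'a::euclidean_space set \<Rightarrow> ereal" where
  "convexity_bound M =
     min (injectivity_radius M / 2)
         (if sectional_curvatures M = {} then \<infinity>
          else ereal (pi / (2 * sqrt (Sup (sectional_curvatures M)))))"

subsection \<open>Geodesics between nearby points, and angles\<close>

definition rlog :: "'a::euclidean_space set \<Rightarrow> 'a \<Rightarrow> 'a \<Rightarrow> 'a" where
  "rlog M P Q =
     (THE v. v \<in> tangent_space M P \<and> ereal (norm v) < injectivity_radius M \<and> Exp M P v = Q)"

definition geodesic_point :: "'a::euclidean_space set \<Rightarrow> 'a \<Rightarrow> 'a \<Rightarrow> real \<Rightarrow> 'a" where
  "geodesic_point M P Q t = Exp M P (t *\<^sub>R rlog M P Q)"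

definition geodesic_midpoint :: "'a::euclidean_space set \<Rightarrow> 'a \<Rightarrow> 'a \<Rightarrow> 'a" where
  "geodesic_midpoint M P Q = geodesic_point M P Q (1/2)"

definition vec_angle :: "'a::euclidean_space \<Rightarrow> 'a \<Rightarrow> real" where
  "vec_angle u v = arccos ((u \<bullet> v) / (norm u * norm v))"

text \<open>\<open>angle_at M P Q R\<close> is the angle at the vertex \<open>P\<close> of the geodesic triangle \<open>P, Q, R\<close>.\<close>

definition angle_at :: "'a::euclidean_space set \<Rightarrow> 'a \<Rightarrow> 'a \<Rightarrow> 'a \<Rightarrow> real" where
  "angle_at M P Q R = vec_angle (rlog M P Q) (rlog M P R)"

section \<open>The Grassmannian\<close>

definition conj_transpose :: "'f::real_or_complex^'n^'m \<Rightarrow> 'f^'m^'n" where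
  "conj_transpose X = map_matrix cconj (transpose X)"

definition Gr :: "nat \<Rightarrow> ('f::real_or_complex^'n^'n) set" where
  "Gr k = {P. P ** P = P \<and> conj_transpose P = P \<and> rank P = k}"

text \<open>
  Tangent vectors of the Grassmannian are self-adjoint, so its Frobenius metric is the one
  induced by the ambient inner product, by the following identity.
\<close>

lemma of_real_inner_conj:
  fixes x y :: "'f::real_or_complex"
  shows "of_real (2 * (x \<bullet> y)) = x * cconj y + y * cconj x"
proof -
  have "(norm (x + y))\<^sup>2 = (norm x)\<^sup>2 + 2 * (x \<bullet> y) + (norm y)\<^sup>2"
    by (simp add: power2_norm_eq_inner inner_add inner_commute)
  then have "of_real (2 * (x \<bullet> y)) =
      (x + y) * cconj (x + y) - x * cconj x - y * cconj y"
    unfolding mult_conj by (simp add: scaleR_conv_of_real algebra_simps)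
  then show ?thesis
    by (simp add: conj_add algebra_simps)
qed

lemma frobenius_inner_eq_trace:
  fixes X Y :: "'f::real_or_complex^'n^'n"
  assumes "conj_transpose X = X" "conj_transpose Y = Y"
  shows "trace (X ** Y) = of_real (X \<bullet> Y)"
proof -
  have X: "cconj (X $ i $ j) = X $ j $ i" and Y: "cconj (Y $ i $ j) = Y $ j $ i" for i j
    using arg_cong[OF assms(1), of "\<lambda>Z. Z $ j $ i"] arg_cong[OF assms(2), of "\<lambda>Z. Z $ j $ i"]
    by (simp_all add: conj_transpose_def map_matrix_def transpose_def)
  have "of_real (2 * (X \<bullet> Y)) = (\<Sum>i\<in>UNIV. \<Sum>j\<in>UNIV. (of_real (2 * (X $ i $ j \<bullet> Y $ i $ j)) :: 'f))"
    by (simp add: inner_vec_def sum_distrib_left)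
  also have "\<dots> = (\<Sum>i\<in>UNIV. \<Sum>j\<in>UNIV. X $ i $ j * Y $ j $ i + Y $ i $ j * X $ j $ i)"
    unfolding of_real_inner_conj X Y ..
  also have "\<dots> = trace (X ** Y) + trace (Y ** X)"
    by (simp add: trace_def matrix_matrix_mult_def sum.distrib)
  also have "\<dots> = 2 * trace (X ** Y)"
    using trace_mul_sym[of Y X] by simp
  finally show ?thesis by simp
qed

end

theory Submission
  imports Defs
begin

text \<open>
  Only nonnegativity of the curvature matters, in the form that \<open>Exp\<^sub>P\<close> does not increase distances.
  With \<open>K = [X, P]\<close> the geodesics are \<open>exp (tK) P exp (- tK)\<close>, and
  \<open>\<parallel>exp K P exp (- K) - exp L P exp (- L)\<parallel> \<le> \<parallel>K - L\<parallel>\<close> for skew-adjoint \<open>K\<close>, \<open>L\<close>, because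
  \<open>exp (- sK) exp (sL)\<close> moves \<open>P\<close> with speed at most \<open>\<parallel>K - L\<parallel>\<close>.

  That the distance of \<open>P\<close> and \<open>Q\<close> is attained by a geodesic is shown by discretization. A chain from
  \<open>P\<close> to \<open>Q\<close> in \<open>N\<close> steps that minimizes the sum of the squared chords has constant commutator
  \<open>\<kappa> = [P\<^bsub>i+1\<^esub>, P\<^sub>i]\<close>, so it follows the one-parameter group of \<open>\<kappa>\<close> up to an error \<open>O(1/N)\<close>. As
  \<open>N \<rightarrow> \<infinity>\<close>, \<open>N\<kappa>\<close> accumulates at some \<open>K\<close> with \<open>exp K P exp (- K) = Q\<close> whose norm is at most
  the length of any given path from \<open>P\<close> to \<open>Q\<close>. Applied to the image under \<open>Exp\<^sub>P\<close> of a segment, the same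
  argument turns the Lipschitz estimate into the law of cosines. The law of cosines at the midpoint gives the
  semi-parallelogram law, and comparison with a Euclidean triangle gives the angle sum.
\<close>

section \<open>Linear flows\<close>

text \<open>This is \<open>exp (t T) x\<close>, written as a series of vectors built from the
  iterates of \<open>T\<close>, so that no Banach algebra of operators has to be set up.\<close>

definition lin_flow :: "('a::euclidean_space \<Rightarrow> 'a) \<Rightarrow> real \<Rightarrow> 'a \<Rightarrow> 'a" where
  "lin_flow T t x = (\<Sum>n. (t ^ n / fact n) *\<^sub>R (T ^^ n) x)"

lemma lin_flow_summable:
  fixes T :: "'a::euclidean_space \<Rightarrow> 'a"
  assumes "bounded_linear T"
  shows "summable (\<lambda>n. (t ^ n / fact n) *\<^sub>R (T ^^ n) x)"
proof -
  obtain B where B: "B > 0" "\<And>x. norm (T x) \<le> norm x * B"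
    using bounded_linear.pos_bounded[OF assms] by blast
  have pow: "norm ((T ^^ n) x) \<le> norm x * B ^ n" for n
  proof (induction n)
    case (Suc n)
    have "norm ((T ^^ Suc n) x) \<le> norm ((T ^^ n) x) * B"
      using B(2)[of "(T ^^ n) x"] by simp
    also have "\<dots> \<le> (norm x * B ^ n) * B"
      using Suc B(1) by (intro mult_right_mono) auto
    finally show ?case by (simp add: mult_ac)
  qed simp
  have "summable (\<lambda>n. norm x * (inverse (fact n) * (\<bar>t\<bar> * B) ^ n))"
    by (intro summable_mult summable_exp)
  then show ?thesis
  proof (rule summable_comparison_test[rotated], intro exI allI impI)
    fix n
    have "norm ((t ^ n / fact n) *\<^sub>R (T ^^ n) x) \<le> (\<bar>t\<bar> ^ n / fact n) * (norm x * B ^ n)"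
      using pow[of n] by (simp add: power_abs mult_left_mono divide_right_mono)
    then show "norm ((t ^ n / fact n) *\<^sub>R (T ^^ n) x) \<le> norm x * (inverse (fact n) * (\<bar>t\<bar> * B) ^ n)"
      by (simp add: power_mult_distrib divide_inverse mult_ac)
  qed
qed

text \<open>Pairing with a fixed \<open>y\<close> gives a scalar power series in \<open>t\<close>,
  to which termwise differentiation applies.\<close>

lemma lin_flow_inner:
  assumes "bounded_linear T"
  shows "lin_flow T t x \<bullet> y = (\<Sum>n. ((T ^^ n) x \<bullet> y / fact n) * t ^ n)"
    and "summable (\<lambda>n. ((T ^^ n) x \<bullet> y / fact n) * t ^ n)"
  using bounded_linear.suminf[OF bounded_linear_inner_left lin_flow_summable[OF assms, of t x], of y]
    bounded_linear.summable[OF bounded_linear_inner_left lin_flow_summable[OF assms, of t x], of y]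
  by (simp_all add: lin_flow_def mult_ac)

lemma lin_flow_0 [simp]: "lin_flow T 0 x = x"
proof -
  have "(\<Sum>n. ((0::real) ^ n / fact n) *\<^sub>R (T ^^ n) x) = (\<Sum>n. if n = 0 then x else 0)"
    by (intro suminf_cong) auto
  then show ?thesis
    using suminf_finite[of "{0}" "\<lambda>n. if n = 0 then x else 0"] by (simp add: lin_flow_def)
qed

lemma lin_flow_commute:
  assumes "bounded_linear T"
  shows "T (lin_flow T t x) = lin_flow T t (T x)"
proof -
  have "T (lin_flow T t x) = (\<Sum>n. T ((t ^ n / fact n) *\<^sub>R (T ^^ n) x))"
    unfolding lin_flow_def by (rule bounded_linear.suminf[OF assms lin_flow_summable[OF assms]])
  also have "\<dots> = lin_flow T t (T x)"
    unfolding lin_flow_def using assms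
    by (simp add: linear_simps funpow_swap1)
  finally show ?thesis .
qed

text \<open>Differentiation is done coordinate by coordinate: \<open>diffs\<close> shifts the
  coefficients, which replaces \<open>x\<close> by \<open>T x\<close>, and \<open>T\<close> commutes
  with the flow.\<close>

lemma lin_flow_has_vector_derivative:
  assumes "bounded_linear T"
  shows "((\<lambda>t. lin_flow T t x) has_vector_derivative T (lin_flow T t x)) (at t)"
proof -
  have "((\<lambda>t. lin_flow T t x \<bullet> y) has_real_derivative T (lin_flow T t x) \<bullet> y) (at t)" for y
  proof -
    define c where "c = (\<lambda>n. (T ^^ n) x \<bullet> y / fact n)"
    have "DERIV (\<lambda>t. \<Sum>n. c n * t ^ n) t :> (\<Sum>n. diffs c n * t ^ n)"
      by (rule termdiffs_strong_converges_everywhere)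
        (use lin_flow_inner(2)[OF assms] in \<open>simp add: c_def\<close>)
    moreover have "diffs c = (\<lambda>n. (T ^^ n) (T x) \<bullet> y / fact n)"
      unfolding diffs_def c_def fun_eq_iff fact_Suc
      by (simp del: of_nat_Suc add: funpow_swap1)
    ultimately show ?thesis
      by (simp add: lin_flow_inner(1)[OF assms] lin_flow_commute[OF assms] c_def)
  qed
  then show ?thesis
    unfolding has_vector_derivative_def
    by (subst has_derivative_componentwise_within)
      (simp add: has_field_derivative_def mult.commute[of "_ \<bullet> _"] mult_commute_abs)
qed

lemma lin_flow_scaleR:
  assumes "bounded_linear T"
  shows "lin_flow (\<lambda>x. s *\<^sub>R T x) t x = lin_flow T (s * t) x"
proof -
  have "((\<lambda>x. s *\<^sub>R T x) ^^ n) x = s ^ n *\<^sub>R (T ^^ n) x" for n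
    by (induction n) (use assms in \<open>simp_all add: linear_simps\<close>)
  then show ?thesis
    by (simp add: lin_flow_def power_mult_distrib mult_ac)
qed

section \<open>Matrix algebra\<close>

lemma matrix_diff_ldistrib: "A ** (B - C) = A ** B - A ** (C :: 'f::ring_1^'n^'m)"
  by (vector matrix_matrix_mult_def right_diff_distrib sum_subtractf)

lemma matrix_diff_rdistrib: "(B - C) ** A = B ** A - C ** (A :: 'f::ring_1^'n^'m)"
  by (vector matrix_matrix_mult_def left_diff_distrib sum_subtractf)

lemma matrix_minus_left: "(- A) ** B = - (A ** (B :: 'f::ring_1^'n^'m))"
  by (vector matrix_matrix_mult_def sum_negf)

lemma matrix_minus_right: "A ** (- B) = - (A ** (B :: 'f::ring_1^'n^'m))"
  by (vector matrix_matrix_mult_def sum_negf)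

lemma matrix_scaleR_left: "(r *\<^sub>R A) ** B = r *\<^sub>R (A ** (B :: 'f::real_algebra_1^'n^'m))"
  by (simp add: matrix_matrix_mult_def vec_eq_iff scaleR_sum_right)

lemma matrix_scaleR_right: "A ** (r *\<^sub>R B) = r *\<^sub>R (A ** (B :: 'f::real_algebra_1^'n^'m))"
  by (simp add: matrix_matrix_mult_def vec_eq_iff scaleR_sum_right)

lemma matrix_add_rdist: "(B + C) ** A = B ** A + C ** (A :: 'f::semiring_1^'n^'m)"
  by (vector matrix_matrix_mult_def distrib_right sum.distrib)

lemmas matrix_distribs = matrix_add_ldistrib matrix_add_rdist matrix_diff_ldistrib matrix_diff_rdistrib
  matrix_minus_left matrix_minus_right matrix_scaleR_left matrix_scaleR_right

lemma bounded_bilinear_matrix_mult: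
  "bounded_bilinear ((**) :: 'f::{real_normed_algebra_1,euclidean_space}^'n^'m \<Rightarrow> 'f^'p^'n \<Rightarrow> _)"
proof (subst bilinear_conv_bounded_bilinear[symmetric], unfold bilinear_def, intro conjI allI)
qed (intro linearI; simp add: matrix_distribs)+

section \<open>Conjugation, the adjoint and the Frobenius inner product\<close>

lemma cconj_0 [simp]: "cconj 0 = (0 :: 'f::real_or_complex)"
  using conj_add[of "0::'f" 0] by simp

lemma cconj_minus: "cconj (- x) = - cconj (x :: 'f::real_or_complex)"
  using conj_add[of x "-x"] by (simp add: eq_neg_iff_add_eq_0 add.commute)

text \<open>By \<open>of_real_inner_conj\<close> the real inner product is half of
  \<open>x * cconj y + y * cconj x\<close>, an expression in which \<open>a\<close> can be moved
  across.\<close>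

lemma inner_mult_left_conj:
  fixes a x y :: "'f::real_or_complex"
  shows "(a * x) \<bullet> y = x \<bullet> (cconj a * y)"
proof -
  have "(of_real (2 * ((a * x) \<bullet> y)) :: 'f) = of_real (2 * (x \<bullet> (cconj a * y)))"
    unfolding of_real_inner_conj by (simp add: conj_mult conj_conj mult_ac)
  then show ?thesis
    by (metis of_real_eq_iff mult_cancel_left zero_neq_numeral)
qed

lemma inner_cconj:
  fixes x y :: "'f::real_or_complex"
  shows "cconj x \<bullet> cconj y = x \<bullet> y"
proof -
  have "(of_real (2 * (cconj x \<bullet> cconj y)) :: 'f) = of_real (2 * (x \<bullet> y))"
    unfolding of_real_inner_conj by (simp add: conj_conj mult_ac)
  then show ?thesis
    by (metis of_real_eq_iff mult_cancel_left zero_neq_numeral)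
qed

lemma cconj_1 [simp]: "cconj 1 = (1 :: 'f::real_or_complex)"
  using mult_conj[of "1::'f"] by simp

lemma cconj_sum: "cconj (sum f S) = (\<Sum>i\<in>S. cconj (f i :: 'f::real_or_complex))"
  by (induction S rule: infinite_finite_induct) (simp_all add: conj_add)

lemma cconj_of_real [simp]: "cconj (of_real r) = (of_real r :: 'f::real_or_complex)"
proof -
  have "(of_real (2 * ((of_real r) \<bullet> (1::'f))) :: 'f) = of_real r + cconj (of_real r)"
    unfolding of_real_inner_conj by simp
  moreover have "(of_real r) \<bullet> (1::'f) = r"
    by (simp add: of_real_def dot_square_norm)
  ultimately show ?thesis by simp
qed

lemma cconj_scaleR: "cconj (r *\<^sub>R x) = r *\<^sub>R cconj (x :: 'f::real_or_complex)"
  by (simp add: scaleR_conv_of_real conj_mult)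

lemma conj_transpose_nth [simp]: "conj_transpose X $ i $ j = cconj (X $ j $ i)"
  by (simp add: conj_transpose_def map_matrix_def transpose_def)

lemma conj_transpose_conj_transpose [simp]: "conj_transpose (conj_transpose X) = X"
  by (simp add: vec_eq_iff conj_conj)

lemma conj_transpose_mult: "conj_transpose (X ** Y) = conj_transpose Y ** conj_transpose X"
  by (simp add: vec_eq_iff matrix_matrix_mult_def cconj_sum conj_mult mult.commute)

lemma conj_transpose_add: "conj_transpose (X + Y) = conj_transpose X + conj_transpose Y"
  by (simp add: vec_eq_iff conj_add)

lemma conj_transpose_minus: "conj_transpose (- X) = - conj_transpose X"
  by (simp add: vec_eq_iff cconj_minus)

lemma conj_transpose_diff: "conj_transpose (X - Y) = conj_transpose X - conj_transpose Y"
  using conj_transpose_add[of X "- Y"] by (simp add: conj_transpose_minus)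

lemma conj_transpose_scaleR: "conj_transpose (r *\<^sub>R X) = r *\<^sub>R conj_transpose X"
  by (simp add: vec_eq_iff cconj_scaleR)

lemma conj_transpose_mat_1 [simp]: "conj_transpose (mat 1) = mat 1"
  by (simp add: vec_eq_iff mat_def)

lemma conj_transpose_0 [simp]: "conj_transpose 0 = 0"
  by (simp add: vec_eq_iff)

lemmas conj_transpose_simps = conj_transpose_mult conj_transpose_add conj_transpose_minus
  conj_transpose_diff conj_transpose_scaleR

lemma inner_conj_transpose: "conj_transpose X \<bullet> conj_transpose Y = X \<bullet> Y"
  unfolding inner_vec_def conj_transpose_nth inner_cconj by (rule sum.swap)

lemma bounded_linear_conj_transpose:
  "bounded_linear (conj_transpose :: 'f::real_or_complex^'n^'m \<Rightarrow> _)"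
  by (intro linear_conv_bounded_linear[THEN iffD1] linearI conj_transpose_add conj_transpose_scaleR)

text \<open>Entrywise this is \<open>inner_mult_left_conj\<close>; the rest reorders a triple
  sum.\<close>

lemma inner_matrix_mult_left:
  "(A ** X) \<bullet> Y = X \<bullet> (conj_transpose A ** (Y :: 'f::real_or_complex^'n^'m))"
proof -
  have "(A ** X) \<bullet> Y = (\<Sum>i\<in>UNIV. \<Sum>j\<in>UNIV. \<Sum>l\<in>UNIV. X $ l $ j \<bullet> (cconj (A $ i $ l) * Y $ i $ j))"
    by (simp add: inner_vec_def matrix_matrix_mult_def inner_sum_left inner_mult_left_conj)
  also have "\<dots> = (\<Sum>j\<in>UNIV. \<Sum>l\<in>UNIV. \<Sum>i\<in>UNIV. X $ l $ j \<bullet> (cconj (A $ i $ l) * Y $ i $ j))"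
    by (subst sum.swap, intro sum.cong refl, rule sum.swap)
  also have "\<dots> = (\<Sum>l\<in>UNIV. \<Sum>j\<in>UNIV. \<Sum>i\<in>UNIV. X $ l $ j \<bullet> (cconj (A $ i $ l) * Y $ i $ j))"
    by (rule sum.swap)
  also have "\<dots> = X \<bullet> (conj_transpose A ** Y)"
    by (simp add: inner_vec_def matrix_matrix_mult_def inner_sum_right)
  finally show ?thesis .
qed

lemma inner_matrix_mult_right:
  "(X ** A) \<bullet> Y = X \<bullet> ((Y :: 'f::real_or_complex^'n^'m) ** conj_transpose A)"
proof -
  have "(X ** A) \<bullet> Y = (conj_transpose A ** conj_transpose X) \<bullet> conj_transpose Y"
    by (metis conj_transpose_mult inner_conj_transpose)
  also have "\<dots> = X \<bullet> (Y ** conj_transpose A)"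
    unfolding inner_matrix_mult_left
    by (metis conj_transpose_mult inner_conj_transpose conj_transpose_conj_transpose)
  finally show ?thesis .
qed

section \<open>The rank of a product\<close>

lemma rows_mult_subset:
  fixes A :: "'f::field^'n^'m" and B :: "'f^'p^'n"
  shows "rows (A ** B) \<subseteq> vec.span (rows B)"
proof
  fix v assume "v \<in> rows (A ** B)"
  then obtain i where "v = row i (A ** B)" by (auto simp: rows_def)
  also have "row i (A ** B) = (\<Sum>l\<in>UNIV. A $ i $ l *s row l B)"
    by (simp add: row_def matrix_matrix_mult_def vec_eq_iff)
  also have "\<dots> \<in> vec.span (rows B)"
    by (intro vec.span_sum vec.span_scale vec.span_base) (auto simp: rows_def)
  finally show "v \<in> vec.span (rows B)" .
qed

lemma rank_mult_le_right:
  fixes A :: "'f::field^'n^'m" and B :: "'f^'p^'n"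
  shows "rank (A ** B) \<le> rank B"
  unfolding row_rank_def_gen using rows_mult_subset by (metis vec.dim_mono)

text \<open>The rows of \<open>A ** B\<close> are the images of the rows of \<open>A\<close> under a
  linear map, and such a map does not raise the dimension.\<close>

lemma rank_mult_le_left:
  fixes A :: "'f::field^'n^'m" and B :: "'f^'n^'n"
  shows "rank (A ** B) \<le> rank A"
proof -
  have lin: "Vector_Spaces.linear (*s) (*s) (\<lambda>v. v v* B)"
    by unfold_locales (simp_all add: vector_matrix_mult_def vec_eq_iff algebra_simps sum.distrib sum_distrib_left)
  have "row i (A ** B) = row i A v* B" for i
    by (simp add: row_def matrix_matrix_mult_def vector_matrix_mult_def vec_eq_iff mult.commute)
  then have "rows (A ** B) = (\<lambda>v. v v* B) ` rows A"
    by (auto simp: rows_def)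
  then show ?thesis
    unfolding row_rank_def_gen using vec.dim_image_le[OF lin] by simp
qed

lemma rank_mult_invertible:
  fixes A G H :: "'f::field^'n^'n"
  assumes "G ** H = mat 1"
  shows "rank (A ** G) = rank A" "rank (H ** A) = rank A"
proof -
  have "A ** G ** H = A" "G ** (H ** A) = A"
    using assms by (simp_all add: matrix_mul_assoc[symmetric], simp add: matrix_mul_assoc)
  then show "rank (A ** G) = rank A" "rank (H ** A) = rank A"
    by (metis antisym rank_mult_le_left rank_mult_le_right)+
qed

section \<open>One-parameter groups of unitary conjugations\<close>

lemma has_vector_derivative_zero_const:
  fixes f :: "real \<Rightarrow> 'a::real_normed_vector"
  assumes "\<And>t. (f has_vector_derivative 0) (at t)"
  shows "f s = f t"
  using has_derivative_zero_unique[of UNIV f s t] assms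
  by (simp add: has_vector_derivative_def)

lemma has_vector_derivative_bound:
  fixes f :: "real \<Rightarrow> 'a::real_normed_vector"
  assumes "\<And>t. t \<in> {0..1} \<Longrightarrow> (f has_vector_derivative f' t) (at t)"
    and "\<And>t. t \<in> {0..1} \<Longrightarrow> norm (f' t) \<le> B"
  shows "norm (f 1 - f 0) \<le> B"
proof -
  have "norm (f 1 - f 0) \<le> B * norm (1 - 0 :: real)"
  proof (rule differentiable_bound[where S = "{0..1}"])
    fix t :: real assume t: "t \<in> {0..1}"
    show "(f has_derivative (\<lambda>h. h *\<^sub>R f' t)) (at t within {0..1})"
      using assms(1)[OF t] by (simp add: has_vector_derivative_def has_derivative_at_withinI)
    show "onorm (\<lambda>h. h *\<^sub>R f' t) \<le> B"
      by (rule onorm_le) (use assms(2)[OF t] in \<open>simp add: mult.commute[of B] mult_left_mono\<close>)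
  qed auto
  then show ?thesis by simp
qed

lemmas has_vector_derivative_matrix_mult =
  bounded_bilinear.has_vector_derivative[OF bounded_bilinear_matrix_mult]

lemmas has_vector_derivative_conj_transpose =
  bounded_linear.has_vector_derivative[OF bounded_linear_conj_transpose]

section \<open>The exponential of a skew-adjoint matrix\<close>

text \<open>The usual exponential series, obtained as the time-one flow of left multiplication by
  \<open>K\<close> started at the identity, so that its derivative comes from
  \<open>lin_flow\<close>.\<close>

definition mexp :: "'f::real_or_complex^'n^'n \<Rightarrow> 'f^'n^'n" where
  "mexp K = lin_flow (\<lambda>X. K ** X) 1 (mat 1)"

lemma bounded_linear_matrix_mult_left:
  "bounded_linear (\<lambda>X :: 'f::real_or_complex^'n^'n. K ** X)"
  by (rule bounded_bilinear.bounded_linear_right[OF bounded_bilinear_matrix_mult])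

lemma mexp_scaleR: "mexp (t *\<^sub>R K) = lin_flow (\<lambda>X. K ** X) t (mat 1)"
  using lin_flow_scaleR[OF bounded_linear_matrix_mult_left, of t K 1 "mat 1"]
  by (simp add: mexp_def matrix_scaleR_left)

lemma mexp_0 [simp]: "mexp 0 = mat 1"
  using mexp_scaleR[of 0 0] by simp

lemma mexp_has_vector_derivative:
  "((\<lambda>t. mexp (t *\<^sub>R K)) has_vector_derivative K ** mexp (t *\<^sub>R K)) (at t)"
  unfolding mexp_scaleR by (rule lin_flow_has_vector_derivative[OF bounded_linear_matrix_mult_left])

definition skew :: "'f::real_or_complex^'n^'n \<Rightarrow> bool" where
  "skew K \<longleftrightarrow> conj_transpose K = - K"

lemma skew_0 [simp]: "skew 0"
  and skew_scaleR: "skew K \<Longrightarrow> skew (r *\<^sub>R K)"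
  and skew_minus: "skew K \<Longrightarrow> skew (- K)"
  and skew_add: "skew K \<Longrightarrow> skew L \<Longrightarrow> skew (K + L)"
  and skew_diff: "skew K \<Longrightarrow> skew L \<Longrightarrow> skew (K - L)"
  by (simp_all add: skew_def conj_transpose_simps)

lemma mexp_conj_has_vector_derivative:
  assumes "skew K"
  shows "((\<lambda>t. conj_transpose (mexp (t *\<^sub>R K))) has_vector_derivative
    - (conj_transpose (mexp (t *\<^sub>R K)) ** K)) (at t)"
  using has_vector_derivative_conj_transpose[OF mexp_has_vector_derivative[of K t]] assms
  by (simp add: conj_transpose_mult skew_def matrix_minus_right)

text \<open>With U = exp(tK), the derivative of U* U is - U* K U + U* K U = 0, so U* U keeps its
  value at t = 0.\<close>

lemma mexp_unitary:
  assumes "skew K"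
  shows "conj_transpose (mexp K) ** mexp K = mat 1" "mexp K ** conj_transpose (mexp K) = mat 1"
proof -
  let ?f = "\<lambda>t. conj_transpose (mexp (t *\<^sub>R K)) ** mexp (t *\<^sub>R K)"
  have "(?f has_vector_derivative 0) (at t)" for t
    using has_vector_derivative_matrix_mult[OF mexp_conj_has_vector_derivative[OF assms, of t] mexp_has_vector_derivative[of K t]]
    by (simp add: matrix_minus_left matrix_mul_assoc)
  from has_vector_derivative_zero_const[of ?f, OF this, of 1 0]
  show "conj_transpose (mexp K) ** mexp K = mat 1" by simp
  then show "mexp K ** conj_transpose (mexp K) = mat 1"
    using matrix_left_right_inverse by blast
qed

lemma matrix_cancel:
  fixes V W X :: "'f::semiring_1^'n^'n"
  assumes "V ** W = mat 1"
  shows "V ** (W ** X) = X" "X ** V ** W = X"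
  using assms by (simp_all add: matrix_mul_assoc, simp add: matrix_mul_assoc[symmetric])

lemma norm_unitary_mult:
  fixes V X :: "'f::real_or_complex^'n^'n"
  assumes "conj_transpose V ** V = mat 1"
  shows "norm (V ** X) = norm X" "norm (X ** conj_transpose V) = norm X"
proof -
  show "norm (V ** X) = norm X"
    using assms by (simp add: norm_eq_sqrt_inner inner_matrix_mult_left matrix_mul_assoc)
  show "norm (X ** conj_transpose V) = norm X"
    using assms by (simp add: norm_eq_sqrt_inner inner_matrix_mult_right matrix_mul_assoc[symmetric])
qed

section \<open>Commutators and unitary conjugation\<close>

definition mcomm :: "'f::real_or_complex^'n^'n \<Rightarrow> 'f^'n^'n \<Rightarrow> 'f^'n^'n" where
  "mcomm X Y = X ** Y - Y ** X"

lemma bounded_bilinear_mcomm: "bounded_bilinear mcomm"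
  unfolding mcomm_def
  by (intro bilinear_conv_bounded_bilinear[THEN iffD1])
    (auto simp: bilinear_def matrix_distribs algebra_simps intro!: linearI)

lemmas mcomm_simps = bounded_bilinear.add_left[OF bounded_bilinear_mcomm]
  bounded_bilinear.add_right[OF bounded_bilinear_mcomm]
  bounded_bilinear.diff_left[OF bounded_bilinear_mcomm]
  bounded_bilinear.diff_right[OF bounded_bilinear_mcomm]
  bounded_bilinear.minus_left[OF bounded_bilinear_mcomm]
  bounded_bilinear.minus_right[OF bounded_bilinear_mcomm]
  bounded_bilinear.scaleR_left[OF bounded_bilinear_mcomm]
  bounded_bilinear.scaleR_right[OF bounded_bilinear_mcomm]
  bounded_bilinear.zero_left[OF bounded_bilinear_mcomm]
  bounded_bilinear.zero_right[OF bounded_bilinear_mcomm]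

lemma mcomm_anticommute: "mcomm X Y = - mcomm Y X"
  by (simp add: mcomm_def)

lemma mcomm_self [simp]: "mcomm X X = 0"
  by (simp add: mcomm_def)

lemma conj_transpose_mcomm:
  "conj_transpose (mcomm X Y) = mcomm (conj_transpose Y) (conj_transpose X)"
  by (simp add: mcomm_def conj_transpose_simps)

lemma skew_mcomm:
  assumes "conj_transpose X = X" "conj_transpose Y = Y"
  shows "skew (mcomm X Y)"
  using assms by (simp add: skew_def conj_transpose_mcomm mcomm_anticommute[of Y X])

text \<open>For self-adjoint \<open>Y\<close> this makes commutation with \<open>Y\<close> a
  symmetric operator for the Frobenius product.\<close>

lemma inner_mcomm:
  "mcomm X Y \<bullet> Z = X \<bullet> mcomm Z (conj_transpose Y)"
  unfolding mcomm_def inner_diff_left inner_diff_right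
  inner_matrix_mult_right[of X Y Z] inner_matrix_mult_left[of Y X Z] ..

text \<open>The conjugate transpose stands for the inverse of \<open>mexp K\<close>, which it is for
  skew-adjoint \<open>K\<close> by \<open>mexp_unitary\<close>.\<close>

definition rot :: "'f::real_or_complex^'n^'n \<Rightarrow> 'f^'n^'n \<Rightarrow> 'f^'n^'n" where
  "rot K X = mexp K ** X ** conj_transpose (mexp K)"

lemma rot_0 [simp]: "rot 0 X = X"
  by (simp add: rot_def)

lemma rot_diff: "rot K (X - Y) = rot K X - rot K Y"
  by (simp add: rot_def matrix_distribs)

lemma rot_has_vector_derivative:
  assumes "skew K"
  shows "((\<lambda>t. rot (t *\<^sub>R K) X) has_vector_derivative mcomm K (rot (t *\<^sub>R K) X)) (at t)"
proof -
  have 1: "((\<lambda>t. mexp (t *\<^sub>R K) ** X) has_vector_derivative K ** mexp (t *\<^sub>R K) ** X) (at t)"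
    using has_vector_derivative_matrix_mult[OF mexp_has_vector_derivative[of K t] has_vector_derivative_const[of X]]
    by simp
  show ?thesis
    using has_vector_derivative_matrix_mult[OF 1 mexp_conj_has_vector_derivative[OF assms]]
    by (simp add: rot_def mcomm_def matrix_mul_assoc matrix_minus_right)
qed

text \<open>Pulling \<open>g\<close> back by the unitary flow gives a curve with derivative zero.
  This is how a curve is recognized as an orbit of the one-parameter group.\<close>

lemma rot_unique:
  assumes K: "skew K" and g: "\<And>t. (g has_vector_derivative mcomm K (g t)) (at t)"
  shows "g t = rot (t *\<^sub>R K) (g 0)"
proof -
  define U where "U t = mexp (t *\<^sub>R K)" for t
  let ?h = "\<lambda>t. conj_transpose (U t) ** g t ** U t"
  have "(?h has_vector_derivative 0) (at t)" for t
    using has_vector_derivative_matrix_mult[OF has_vector_derivative_matrix_mult[OF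
        mexp_conj_has_vector_derivative[OF K, of t] g[of t]] mexp_has_vector_derivative[of K t]]
    unfolding U_def[symmetric]
    by (simp add: mcomm_def matrix_distribs matrix_mul_assoc)
  from has_vector_derivative_zero_const[of ?h, OF this, of t 0]
  have *: "conj_transpose (U t) ** g t ** U t = g 0"
    by (simp add: U_def)
  have "U t ** (conj_transpose (U t) ** g t ** U t) ** conj_transpose (U t) = g t"
    using mexp_unitary(2)[OF skew_scaleR[OF K], of t]
    by (simp add: U_def matrix_cancel matrix_mul_assoc[symmetric])
  then show ?thesis
    unfolding * by (simp add: rot_def U_def)
qed

lemma rot_add:
  assumes "skew K"
  shows "rot ((s + t) *\<^sub>R K) X = rot (s *\<^sub>R K) (rot (t *\<^sub>R K) X)"
proof -
  let ?g = "\<lambda>s. rot ((s + t) *\<^sub>R K) X"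
  have "(?g has_vector_derivative mcomm K (?g s)) (at s)" for s
    using vector_diff_chain_at[of "\<lambda>s. s + t" 1 s "\<lambda>s. rot (s *\<^sub>R K) X" "mcomm K (?g s)"]
      rot_has_vector_derivative[OF assms, of X "s + t"]
    by (simp add: o_def has_vector_derivative_add_const)
  from rot_unique[of K ?g, OF assms this, of s] show ?thesis by simp
qed

lemma rot_minus_cancel:
  assumes "skew K"
  shows "rot (- K) (rot K X) = X"
  using rot_add[OF assms, of "-1" 1 X] by simp

lemma rot_isometric:
  assumes "skew K"
  shows "norm (rot K X - rot K Y) = norm (X - Y)"
  using mexp_unitary(1)[OF assms]
  by (simp add: rot_diff[symmetric]) (simp add: rot_def norm_unitary_mult)

lemma norm_rot: "skew K \<Longrightarrow> norm (rot K X) = norm X"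
  using rot_isometric[of K X 0] by (simp add: rot_def)

definition herm_proj :: "'f::real_or_complex^'n^'n \<Rightarrow> bool" where
  "herm_proj P \<longleftrightarrow> P ** P = P \<and> conj_transpose P = P"

lemma herm_projD:
  assumes "herm_proj P"
  shows "P ** P = P" "X ** P ** P = X ** P" "P ** (P ** X) = P ** X" "conj_transpose P = P"
  using assms unfolding herm_proj_def
  by (simp, simp add: matrix_mul_assoc[symmetric], simp add: matrix_mul_assoc, simp)

lemma herm_proj_conj:
  fixes P V :: "'f::real_or_complex^'n^'n"
  assumes "herm_proj P" "conj_transpose V ** V = mat 1"
  shows "herm_proj (V ** P ** conj_transpose V)"
  using assms(1)
  by (simp add: herm_proj_def conj_transpose_mult matrix_mul_assoc[symmetric] matrix_cancel[OF assms(2)])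
    (simp add: matrix_mul_assoc)

text \<open>In the block decomposition given by \<open>P\<close>, commutation with \<open>P\<close>
  kills the diagonal blocks and multiplies the off-diagonal ones by 1 and -1. Its eigenvalues are
  therefore among 0, 1, -1.\<close>

lemma mcomm_cube:
  assumes "herm_proj P"
  shows "mcomm (mcomm (mcomm X P) P) P = mcomm X P"
  unfolding mcomm_def matrix_distribs matrix_mul_assoc herm_projD[OF assms]
  by (simp only: diff_conv_add_uminus minus_add_distrib minus_minus add_ac) simp

text \<open>A symmetric operator with eigenvalues 0, 1, -1 is a contraction. Concretely, the squared
  norm of \<open>mcomm Z P\<close> is the product of \<open>Z\<close> with the double commutator,
  whose norm equals that of \<open>mcomm Z P\<close> by \<open>mcomm_cube\<close>.\<close>

lemma norm_mcomm_le:
  assumes "herm_proj P"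
  shows "norm (mcomm Z P) \<le> norm Z"
proof -
  note [simp] = herm_projD(4)[OF assms]
  have 1: "(norm (mcomm Z P))\<^sup>2 = Z \<bullet> mcomm (mcomm Z P) P"
    by (simp add: power2_norm_eq_inner inner_mcomm)
  have "(norm (mcomm (mcomm Z P) P))\<^sup>2 = mcomm Z P \<bullet> mcomm Z P"
    unfolding power2_norm_eq_inner by (subst inner_mcomm) (simp add: mcomm_cube[OF assms])
  then have 2: "norm (mcomm (mcomm Z P) P) = norm (mcomm Z P)"
    by (metis norm_eq_sqrt_inner norm_ge_zero real_sqrt_pow2 real_sqrt_unique)
  have "norm (mcomm Z P) * norm (mcomm Z P) \<le> norm Z * norm (mcomm Z P)"
    using 1 norm_cauchy_schwarz[of Z "mcomm (mcomm Z P) P"] 2 by (simp add: power2_eq_square)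
  then show ?thesis
    by (cases "mcomm Z P = 0") auto
qed

lemma rot_lipschitz:
  assumes P: "herm_proj P" and K: "skew K" "skew L"
  shows "norm (rot K P - rot L P) \<le> norm (K - L)"
proof -
  define U where "U t = mexp (t *\<^sub>R K)" for t
  \<comment> \<open>V(t) = exp(-tK) exp(tL) satisfies V' = Z V with Z skew and of norm |K - L|.
    Hence the projection R = V P V* has velocity [Z, R], which \<open>norm_mcomm_le\<close> bounds
    by |K - L|.\<close>
  define V where "V t = conj_transpose (U t) ** mexp (t *\<^sub>R L)" for t
  define Z where "Z t = conj_transpose (U t) ** (L - K) ** U t" for t
  define R where "R t = V t ** P ** conj_transpose (V t)" for t
  have U: "U t ** conj_transpose (U t) = mat 1" "conj_transpose (U t) ** U t = mat 1" for t
    using mexp_unitary[OF skew_scaleR[OF K(1)], of t] by (simp_all add: U_def)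
  have V: "conj_transpose (V t) ** V t = mat 1" for t
    using mexp_unitary[OF skew_scaleR[OF K(2)], of t]
    by (simp add: V_def conj_transpose_mult matrix_mul_assoc[symmetric] matrix_cancel[OF U(1)])
  have Zskew: "conj_transpose (Z t) = - Z t" for t
    using K by (simp add: Z_def conj_transpose_simps skew_def matrix_distribs matrix_mul_assoc)
  have normZ: "norm (Z t) = norm (K - L)" for t
    using norm_unitary_mult[of "conj_transpose (U t)"] U
    by (simp add: Z_def matrix_mul_assoc[symmetric] norm_minus_commute)
  have dV: "(V has_vector_derivative Z t ** V t) (at t)" for t
  proof -
    have "(V has_vector_derivative conj_transpose (U t) ** (L ** mexp (t *\<^sub>R L))
        + - (conj_transpose (U t) ** K) ** mexp (t *\<^sub>R L)) (at t)"
      unfolding V_def[abs_def] U_def[abs_def]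
      by (rule has_vector_derivative_matrix_mult[OF mexp_conj_has_vector_derivative[OF K(1)] mexp_has_vector_derivative])
    moreover have "conj_transpose (U t) ** (L ** mexp (t *\<^sub>R L))
        + - (conj_transpose (U t) ** K) ** mexp (t *\<^sub>R L) = Z t ** V t"
      by (simp add: Z_def V_def matrix_mul_assoc[symmetric] matrix_cancel[OF U(1)])
        (simp add: matrix_distribs matrix_mul_assoc)
    ultimately show ?thesis by simp
  qed
  have dR: "(R has_vector_derivative mcomm (Z t) (R t)) (at t)" for t
  proof -
    have 1: "((\<lambda>t. V t ** P) has_vector_derivative Z t ** V t ** P) (at t)"
      using has_vector_derivative_matrix_mult[OF dV[of t] has_vector_derivative_const[of P]] by simp
    show ?thesis
      using has_vector_derivative_matrix_mult[OF 1 has_vector_derivative_conj_transpose[OF dV]]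
      unfolding R_def[abs_def]
      by (simp add: mcomm_def conj_transpose_mult Zskew matrix_distribs matrix_mul_assoc)
  qed
  have "norm (R 1 - R 0) \<le> norm (K - L)"
  proof (rule has_vector_derivative_bound[OF dR])
    show "norm (mcomm (Z t) (R t)) \<le> norm (K - L)" for t
      using norm_mcomm_le[OF herm_proj_conj[OF P V], of "Z t" t] normZ[of t] by (simp add: R_def)
  qed
  moreover have "R 0 = P" by (simp add: R_def V_def U_def)
  \<comment> \<open>Conjugation by the unitary \<open>U 1\<close> carries \<open>R 1\<close> to
    \<open>rot L P\<close> and \<open>P\<close> to \<open>rot K P\<close>, so it preserves the
    distance just estimated.\<close>
  moreover have "U 1 ** R 1 ** conj_transpose (U 1) = rot L P"
    by (simp add: R_def V_def rot_def conj_transpose_mult matrix_mul_assoc[symmetric] matrix_cancel[OF U(1)] U(1))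
  then have "U 1 ** (R 1 - P) ** conj_transpose (U 1) = rot L P - rot K P"
    by (simp add: matrix_distribs) (simp add: rot_def U_def)
  then have "norm (rot L P - rot K P) = norm (R 1 - P)"
    by (metis norm_unitary_mult U(2))
  ultimately show ?thesis
    by (simp add: norm_minus_commute)
qed

text \<open>The velocity at time t differs from \<open>mcomm K P\<close> by the commutator of
  \<open>K\<close> with \<open>rot (tK) P - P\<close>. By \<open>rot_lipschitz\<close> the latter is
  at most |K|, so the difference is of second order.\<close>

lemma rot_taylor:
  obtains C where "C \<ge> 0"
    and "\<And>K P. skew K \<Longrightarrow> herm_proj P \<Longrightarrow>
       norm (rot K (P :: 'f::real_or_complex^'n^'n) - P - mcomm K P) \<le> C * (norm K)\<^sup>2"
proof -
  obtain C where C: "C \<ge> 0" "\<And>X Y :: 'f^'n^'n. norm (mcomm X Y) \<le> norm X * norm Y * C"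
    using bounded_bilinear.nonneg_bounded[OF bounded_bilinear_mcomm] by blast
  show ?thesis
  proof (rule that[OF C(1)])
    fix K P :: "'f^'n^'n" assume K: "skew K" and P: "herm_proj P"
    let ?h = "\<lambda>t. rot (t *\<^sub>R K) P - t *\<^sub>R mcomm K P"
    have "norm (?h 1 - ?h 0) \<le> C * (norm K)\<^sup>2"
    proof (rule has_vector_derivative_bound)
      fix t :: real assume t: "t \<in> {0..1}"
      show "(?h has_vector_derivative mcomm K (rot (t *\<^sub>R K) P) - mcomm K P) (at t)"
        using has_vector_derivative_diff[OF rot_has_vector_derivative[OF K]
            has_vector_derivative_scaleR[OF DERIV_ident has_vector_derivative_const]]
        by simp
      have "norm (rot (t *\<^sub>R K) P - P) \<le> norm (t *\<^sub>R K)"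
        using rot_lipschitz[OF P skew_scaleR[OF K] skew_0] by simp
      also have "\<dots> \<le> norm K"
        using t by (simp add: mult_left_le_one_le)
      finally have "norm K * norm (rot (t *\<^sub>R K) P - P) * C \<le> norm K * norm K * C"
        using C(1) by (intro mult_right_mono mult_left_mono) auto
      then show "norm (mcomm K (rot (t *\<^sub>R K) P) - mcomm K P) \<le> C * (norm K)\<^sup>2"
        using C(2)[of K "rot (t *\<^sub>R K) P - P"] by (simp add: mcomm_simps power2_eq_square mult_ac)
    qed
    then show "norm (rot K P - P - mcomm K P) \<le> C * (norm K)\<^sup>2"
      by (simp add: algebra_simps)
  qed
qed

text \<open>A Newton step for solving \<open>rot K P = Q\<close>.\<close>

lemma rot_newton:
  obtains C where "C \<ge> 0"
    and "\<And>P Q. herm_proj P \<Longrightarrow> herm_proj Q \<Longrightarrow>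
       norm (rot (mcomm Q P) P - (Q :: 'f::real_or_complex^'n^'n)) \<le> C * (norm (Q - P))\<^sup>2"
proof -
  obtain C1 where C1: "C1 \<ge> 0" "\<And>K P. skew K \<Longrightarrow> herm_proj P \<Longrightarrow>
       norm (rot K (P :: 'f^'n^'n) - P - mcomm K P) \<le> C1 * (norm K)\<^sup>2"
    using rot_taylor by blast
  obtain B where B: "B \<ge> 0" "\<And>(X :: 'f^'n^'n) (Y :: 'f^'n^'n). norm (X ** Y) \<le> norm X * norm Y * B"
    using bounded_bilinear.nonneg_bounded[OF bounded_bilinear_matrix_mult] by blast
  show ?thesis
  proof (rule that[of "C1 + B"])
    fix P Q :: "'f^'n^'n" assume P: "herm_proj P" and Q: "herm_proj Q"
    define D where "D = Q - P"
    \<comment> \<open>The reflection 1 - 2P is unitary, so multiplying by it does not change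
      norms.\<close>
    define E where "E = mat 1 - P - P"
    have unitE: "conj_transpose E ** E = mat 1"
      unfolding E_def conj_transpose_simps matrix_distribs herm_projD[OF P] conj_transpose_mat_1
      by simp
    \<comment> \<open>The first-order step misses \<open>Q\<close> by exactly (1 - 2P)(Q - P)^2,
      which is quadratic in \<open>Q - P\<close>.\<close>
    have "Q - P - mcomm (mcomm Q P) P = E ** (D ** D)"
      unfolding D_def E_def mcomm_def matrix_distribs matrix_mul_assoc herm_projD[OF P] herm_projD[OF Q]
        matrix_mul_lid
      by (simp add: algebra_simps)
    then have "norm (Q - P - mcomm (mcomm Q P) P) = norm (D ** D)"
      by (simp add: norm_unitary_mult[OF unitE])
    also have "\<dots> \<le> B * (norm D)\<^sup>2"
      using B(2)[of D D] by (simp add: power2_eq_square mult_ac)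
    finally have 1: "norm (Q - P - mcomm (mcomm Q P) P) \<le> B * (norm D)\<^sup>2" .
    have "norm (mcomm Q P) \<le> norm D"
      using norm_mcomm_le[OF P, of D] by (simp add: D_def mcomm_simps)
    then have "C1 * (norm (mcomm Q P))\<^sup>2 \<le> C1 * (norm D)\<^sup>2"
      using C1(1) by (intro mult_left_mono power_mono) auto
    then have 2: "norm (rot (mcomm Q P) P - P - mcomm (mcomm Q P) P) \<le> C1 * (norm D)\<^sup>2"
      using C1(2)[of "mcomm Q P" P] P Q by (auto simp: herm_proj_def skew_mcomm)
    have "norm (rot (mcomm Q P) P - Q) \<le> norm (rot (mcomm Q P) P - P - mcomm (mcomm Q P) P)
        + norm (Q - P - mcomm (mcomm Q P) P)"
      using norm_triangle_ineq4[of "rot (mcomm Q P) P - P - mcomm (mcomm Q P) P" "Q - P - mcomm (mcomm Q P) P"]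
      by simp
    then show "norm (rot (mcomm Q P) P - Q) \<le> (C1 + B) * (norm (Q - P))\<^sup>2"
      using 1 2 by (simp add: D_def distrib_right)
  qed (use C1 B in simp)
qed

section \<open>The Grassmannian: compactness, tangent spaces, geodesics\<close>

lemma Gr_iff: "P \<in> Gr k \<longleftrightarrow> herm_proj P \<and> rank P = k"
  by (auto simp: Gr_def herm_proj_def)

lemma rot_in_Gr:
  assumes "skew K" "P \<in> Gr k"
  shows "rot K P \<in> Gr k"
  using assms mexp_unitary[OF assms(1)]
  by (auto simp: Gr_iff rot_def herm_proj_conj rank_mult_invertible)

lemma bounded_bilinear_matrix_vector_mult:
  "bounded_bilinear ((*v) :: 'f::real_or_complex^'n^'m \<Rightarrow> _)"
  unfolding bilinear_conv_bounded_bilinear[symmetric] bilinear_def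
  by (intro conjI allI linearI)
    (simp_all add: matrix_vector_mult_def vec_eq_iff distrib_left distrib_right sum.distrib scaleR_sum_right)

text \<open>If \<open>P - Q\<close> is small, G = 1 - (P - Q) is injective, hence invertible, and PG
  = PQ. So the rank of \<open>P\<close> is that of PQ, at most the rank of \<open>Q\<close>.\<close>

lemma rank_le_near:
  obtains e where "e > 0" and "\<And>P Q :: 'f::real_or_complex^'n^'n. herm_proj P \<Longrightarrow> herm_proj Q \<Longrightarrow>
    norm (P - Q) < e \<Longrightarrow> rank P \<le> rank Q"
proof -
  obtain B where B: "B > 0" "\<And>(A :: 'f^'n^'n) x. norm (A *v x) \<le> norm A * norm x * B"
    using bounded_bilinear.pos_bounded[OF bounded_bilinear_matrix_vector_mult] by blast
  show ?thesis
  proof (rule that[of "1 / B"])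
    fix P Q :: "'f^'n^'n" assume P: "herm_proj P" and Q: "herm_proj Q" and near: "norm (P - Q) < 1 / B"
    define G where "G = mat 1 - (P - Q)"
    have "x = 0" if "G *v x = 0" for x
    proof (rule ccontr)
      assume "x \<noteq> 0"
      have "x = (P - Q) *v x"
        using that by (simp add: G_def matrix_vector_mult_diff_rdistrib)
      then have "norm x \<le> norm (P - Q) * norm x * B"
        using B(2)[of "P - Q" x] by simp
      also have "\<dots> < 1 / B * norm x * B"
        using near B(1) \<open>x \<noteq> 0\<close> by (intro mult_strict_right_mono) auto
      finally show False using B(1) by simp
    qed
    then obtain H where "H ** G = mat 1"
      using matrix_left_invertible_ker[of G] by blast
    then have "G ** H = mat 1"
      using matrix_left_right_inverse by blast
    then have "rank P = rank (P ** G)"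
      by (simp add: rank_mult_invertible)
    also have "P ** G = P ** Q"
      by (simp add: G_def matrix_distribs herm_projD[OF P])
    also have "rank (P ** Q) \<le> rank Q"
      by (rule rank_mult_le_right)
    finally show "rank P \<le> rank Q" .
  qed (use B in simp)
qed

lemma norm_herm_proj_le:
  fixes P :: "'f::real_or_complex^'n^'n"
  assumes "herm_proj P"
  shows "norm P \<le> norm (mat 1 :: 'f^'n^'n)"
proof -
  have "P \<bullet> P = P \<bullet> mat 1"
    using inner_matrix_mult_left[of P P "mat 1"] by (simp add: herm_projD[OF assms])
  then have "norm P * norm P = P \<bullet> mat 1"
    by (metis dot_square_norm power2_eq_square)
  also have "\<dots> \<le> norm P * norm (mat 1 :: 'f^'n^'n)"
    by (rule norm_cauchy_schwarz)
  finally show ?thesis by (cases "P = 0") auto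
qed

section \<open>Compactness of the Grassmannian\<close>

lemma closed_herm_proj: "closed {P :: 'f::real_or_complex^'n^'n. herm_proj P}"
proof -
  have "continuous_on UNIV (\<lambda>P :: 'f^'n^'n. P ** P)"
    by (intro bounded_bilinear.continuous_on[OF bounded_bilinear_matrix_mult] continuous_on_id)
  moreover have "continuous_on UNIV (conj_transpose :: 'f^'n^'n \<Rightarrow> _)"
    by (intro linear_continuous_on bounded_linear_conj_transpose)
  ultimately show ?thesis
    unfolding herm_proj_def by (intro closed_Collect_conj closed_Collect_eq continuous_on_id)
qed

text \<open>Projections form a bounded closed set, and \<open>rank_le_near\<close>, applied both
  ways, makes the rank constant near a limit point.\<close>

lemma compact_Gr: "compact (Gr k :: ('f::real_or_complex^'n^'n) set)"
proof -
  have "bounded (Gr k :: ('f^'n^'n) set)"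
    unfolding bounded_iff by (intro exI[of _ "norm (mat 1 :: 'f^'n^'n)"]) (simp add: Gr_iff norm_herm_proj_le)
  moreover have "closed (Gr k :: ('f^'n^'n) set)"
    unfolding closed_sequential_limits
  proof (intro allI impI, elim conjE)
    fix X :: "nat \<Rightarrow> 'f^'n^'n" and P assume X: "\<forall>n. X n \<in> Gr k" "X \<longlonglongrightarrow> P"
    have P: "herm_proj P"
      using closed_sequentially[OF closed_herm_proj, of X P] X by (auto simp: Gr_iff)
    obtain e where e: "e > 0" "\<And>P Q :: 'f^'n^'n. herm_proj P \<Longrightarrow> herm_proj Q \<Longrightarrow>
        norm (P - Q) < e \<Longrightarrow> rank P \<le> rank Q"
      using rank_le_near by blast
    obtain n where "norm (X n - P) < e"
      using LIMSEQ_D[OF X(2) e(1)] by blast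
    then have "rank P = rank (X n)"
      using e(2)[of P "X n"] e(2)[of "X n" P] P X(1) by (auto simp: Gr_iff norm_minus_commute intro: antisym)
    then show "P \<in> Gr k"
      using P X(1) by (auto simp: Gr_iff)
  qed
  ultimately show ?thesis
    by (simp add: compact_eq_bounded_closed)
qed

text \<open>The linear map \<open>T\<close> is there for the induction: the derivative of T g is T L
  g, again a linear image of \<open>g\<close>.\<close>

lemma Ck_on_flow:
  fixes g :: "real \<Rightarrow> 'a::euclidean_space"
  assumes g: "\<And>t. (g has_vector_derivative L (g t)) (at t)" and L: "bounded_linear L"
  shows "bounded_linear T \<Longrightarrow> Ck_on m U (\<lambda>t. T (g t) :: 'b::euclidean_space)"
proof (induction m arbitrary: T)
  case 0
  have "continuous_on U g"
    by (intro continuous_at_imp_continuous_on ballI has_vector_derivative_continuous[OF g])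
  with 0 show ?case
    by (simp add: bounded_linear.continuous_on)
next
  case (Suc m)
  have "((\<lambda>t. T (g t)) has_derivative (\<lambda>h. h *\<^sub>R T (L (g t)))) (at t)" for t
    using bounded_linear.has_vector_derivative[OF Suc.prems g] by (simp add: has_vector_derivative_def)
  moreover have "Ck_on m U (\<lambda>t. h *\<^sub>R T (L (g t)))" for h
  proof (rule Suc.IH)
    show "bounded_linear (\<lambda>x. h *\<^sub>R T (L x))"
      using bounded_linear_compose[OF bounded_linear_scaleR_right bounded_linear_compose[OF Suc.prems L]] .
  qed
  ultimately show ?case
    unfolding Ck_on.simps by (intro exI[of _ "\<lambda>t h. h *\<^sub>R T (L (g t))"] conjI ballI allI)
qed

lemma smooth_on_rot:
  assumes "skew K"
  shows "smooth_on X (\<lambda>t. rot (t *\<^sub>R K) P)"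
  unfolding smooth_on_def
proof (intro ballI exI conjI allI)
  show "Ck_on m UNIV (\<lambda>t. rot (t *\<^sub>R K) P)" for m
    by (rule Ck_on_flow[where T = "\<lambda>x. x", OF rot_has_vector_derivative[OF assms]])
      (auto intro: bounded_bilinear.bounded_linear_right[OF bounded_bilinear_mcomm] bounded_linear_ident)
qed auto

lemma smooth_on_UNIV_vector_derivative:
  fixes g :: "real \<Rightarrow> 'a::euclidean_space"
  assumes "smooth_on UNIV g"
  defines "g1 \<equiv> \<lambda>s. vector_derivative g (at s)"
  shows "(g has_vector_derivative g1 t) (at t)"
    and "(g1 has_vector_derivative vector_derivative g1 (at t)) (at t)"
proof -
  obtain U F where U: "open U" "t \<in> U" "\<And>y. y \<in> U \<Longrightarrow> F y = g y" and "Ck_on (Suc (Suc 0)) U F"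
    using assms(1) unfolding smooth_on_def by (metis Int_UNIV_right UNIV_I)
  then obtain f' where f': "\<And>x. x \<in> U \<Longrightarrow> (F has_derivative f' x) (at x)" "Ck_on (Suc 0) U (\<lambda>x. f' x 1)"
    by (metis Ck_on.simps(2))
  then obtain f'' where f'': "\<And>x. x \<in> U \<Longrightarrow> ((\<lambda>x. f' x 1) has_derivative f'' x) (at x)"
    by auto
  have d: "(g has_vector_derivative f' x 1) (at x)" if "x \<in> U" for x
  proof -
    have "(F has_vector_derivative f' x 1) (at x)"
      using f'(1)[OF that] has_derivative_bounded_linear[OF f'(1)[OF that]]
      by (simp add: has_vector_derivative_def linear_simps(5)[symmetric])
    then show ?thesis
      by (rule has_vector_derivative_transform_within_open[OF _ U(1) that U(3)])
  qed
  then have g1: "g1 x = f' x 1" if "x \<in> U" for x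
    using that by (simp add: g1_def vector_derivative_at)
  show "(g has_vector_derivative g1 t) (at t)"
    using d[OF U(2)] g1[OF U(2)] by simp
  have "(g1 has_derivative f'' t) (at t)"
    by (rule has_derivative_transform_within_open[OF f''[OF U(2)] U(1,2)]) (simp add: g1)
  then show "(g1 has_vector_derivative vector_derivative g1 (at t)) (at t)"
    using differentiableI vector_derivative_works by blast
qed

section \<open>Tangent spaces\<close>

text \<open>The hypothesis on \<open>v\<close> is the derivative of P^2 = P. Multiplying it by
  \<open>P\<close> on both sides gives PvP = 2 PvP, so PvP = 0 and the double commutator reduces to
  vP + Pv.\<close>

lemma tangent_relation:
  assumes "herm_proj P" "v ** P + P ** v = v"
  shows "mcomm (mcomm v P) P = v"
proof -
  have "P ** (v ** P + P ** v) ** P = P ** v ** P"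
    using assms(2) by simp
  then have "P ** v ** P = 0"
    by (simp add: matrix_distribs matrix_mul_assoc herm_projD[OF assms(1)])
  then have "mcomm (mcomm v P) P = v ** P + P ** v"
    by (simp add: mcomm_def matrix_distribs matrix_mul_assoc herm_projD[OF assms(1)])
  with assms(2) show ?thesis by simp
qed

lemma herm_proj_velocity:
  fixes c :: "real \<Rightarrow> 'f::real_or_complex^'n^'n"
  assumes c: "(c has_vector_derivative v) (at t)" and U: "open U" "t \<in> U" "\<And>s. s \<in> U \<Longrightarrow> herm_proj (c s)"
  shows "conj_transpose v = v" "mcomm (mcomm v (c t)) (c t) = v"
proof -
  have "((\<lambda>s. conj_transpose (c s)) has_vector_derivative v) (at t)"
    by (rule has_vector_derivative_transform_within_open[OF c U(1,2)]) (simp add: herm_projD[OF U(3)])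
  with has_vector_derivative_conj_transpose[OF c] show "conj_transpose v = v"
    using vector_derivative_unique_at by blast
  have "((\<lambda>s. c s ** c s) has_vector_derivative v) (at t)"
    by (rule has_vector_derivative_transform_within_open[OF c U(1,2)]) (simp add: herm_projD[OF U(3)])
  with has_vector_derivative_matrix_mult[OF c c] have "c t ** v + v ** c t = v"
    using vector_derivative_unique_at by blast
  with U show "mcomm (mcomm v (c t)) (c t) = v"
    by (intro tangent_relation) (auto simp: add.commute)
qed

text \<open>One inclusion differentiates the equations of a projection. For the other, the rotation
  generated by [v, P] keeps the rank and has initial velocity [[v, P], P] = v.\<close>

lemma tangent_space_Gr:
  assumes P: "P \<in> Gr k"
  shows "tangent_space (Gr k) P = {v. conj_transpose v = v \<and> mcomm (mcomm v P) P = v}"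
proof (intro equalityI subsetI CollectI)
  fix v assume "v \<in> tangent_space (Gr k) P"
  then obtain c e where c: "e > 0" "c ` {-e<..<e} \<subseteq> Gr k" "c 0 = P" "(c has_vector_derivative v) (at 0)"
    by (auto simp: tangent_space_def curve_with_velocity_def)
  have "herm_proj (c s)" if "s \<in> {-e<..<e}" for s
    using c(2) that by (auto simp: Gr_iff image_subset_iff)
  from herm_proj_velocity[OF c(4) open_greaterThanLessThan[of "-e" e] _ this] c(1,3)
  show "conj_transpose v = v \<and> mcomm (mcomm v P) P = v" by auto
next
  fix v assume "v \<in> {v. conj_transpose v = v \<and> mcomm (mcomm v P) P = v}"
  then have v: "conj_transpose v = v" "mcomm (mcomm v P) P = v" by auto
  have K: "skew (mcomm v P)"
    using v(1) P by (auto intro!: skew_mcomm simp: Gr_iff herm_proj_def)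
  have "curve_with_velocity (Gr k) P v (\<lambda>t. rot (t *\<^sub>R mcomm v P) P)"
    unfolding curve_with_velocity_def
    using rot_has_vector_derivative[OF K, of P 0] v(2) rot_in_Gr[OF skew_scaleR[OF K] P] smooth_on_rot[OF K]
    by (auto intro!: exI[of _ 1])
  then show "v \<in> tangent_space (Gr k) P"
    by (auto simp: tangent_space_def)
qed

lemma subspace_tangent_space_Gr: "P \<in> Gr k \<Longrightarrow> subspace (tangent_space (Gr k) P)"
  by (auto simp: tangent_space_Gr subspace_def conj_transpose_simps mcomm_simps)

text \<open>\<open>tangent_proj\<close> is a definite description; on a subspace the orthogonal
  projection exists and is unique, so the description denotes it.\<close>

lemma tangent_proj_eq_0_iff:
  assumes T: "subspace (tangent_space M P)"
  shows "tangent_proj M P w = 0 \<longleftrightarrow> (\<forall>v\<in>tangent_space M P. w \<bullet> v = 0)"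
proof -
  let ?P = "\<lambda>u. u \<in> tangent_space M P \<and> (\<forall>v\<in>tangent_space M P. (w - u) \<bullet> v = 0)"
  obtain u z where u: "u \<in> span (tangent_space M P)" "\<And>v. v \<in> span (tangent_space M P) \<Longrightarrow> orthogonal z v" "w = u + z"
    using orthogonal_subspace_decomp_exists[of "tangent_space M P" w] by blast
  then have Pu: "?P u"
    using T by (simp add: orthogonal_def) (metis span_eq_iff)
  have uniq: "u' = u" if "?P u'" for u'
  proof -
    have "u' - u \<in> tangent_space M P"
      using that Pu T by (simp add: subspace_diff)
    then have "(w - u) \<bullet> (u' - u) = 0" "(w - u') \<bullet> (u' - u) = 0"
      using that Pu by auto
    then have "(u' - u) \<bullet> (u' - u) = 0"
      by (simp add: inner_diff_left inner_diff_right)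
    then show ?thesis by simp
  qed
  have "?P (tangent_proj M P w)"
    unfolding tangent_proj_def by (rule theI[of ?P, OF Pu uniq])
  moreover have "u = 0" if "\<forall>v\<in>tangent_space M P. w \<bullet> v = 0"
    using uniq[of 0] that subspace_0[OF T] by simp
  ultimately show ?thesis
    using uniq by force
qed

section \<open>Geodesics and the exponential map\<close>

lemma rot_mcomm:
  assumes "skew K"
  shows "rot K (mcomm X Y) = mcomm (rot K X) (rot K Y)"
  by (simp add: rot_def mcomm_def matrix_distribs matrix_mul_assoc[symmetric] matrix_cancel[OF mexp_unitary(1)[OF assms]])

text \<open>Both \<open>K\<close> and [K, P] are off-diagonal in the blocks of \<open>P\<close>, so
  their commutator is block diagonal and commutes with \<open>P\<close>.\<close>

lemma acceleration_commutes:
  assumes "herm_proj P" "mcomm (mcomm K P) P = K"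
  shows "mcomm (mcomm K (mcomm K P)) P = 0"
proof -
  have "P ** mcomm (mcomm K P) P ** P = 0"
    unfolding mcomm_def matrix_distribs matrix_mul_assoc herm_projD[OF assms(1)] by simp
  then have PKP: "P ** K ** P = 0"
    using assms(2) by simp
  have "mcomm (mcomm K P) P = K ** P - P ** K ** P - (P ** K ** P - P ** K)"
    unfolding mcomm_def matrix_distribs matrix_mul_assoc herm_projD[OF assms(1)] ..
  then have KP: "K ** P = K - P ** K"
    using assms(2) by (simp add: PKP eq_diff_eq)
  have XKP: "X ** K ** P = X ** K - X ** P ** K" for X
    by (metis KP matrix_mul_assoc matrix_diff_ldistrib)
  show ?thesis
    unfolding mcomm_def matrix_distribs matrix_mul_assoc
    by (simp add: KP XKP matrix_distribs matrix_mul_assoc herm_projD[OF assms(1)])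
qed

lemma skew_tangent:
  assumes "P \<in> Gr k" "v \<in> tangent_space (Gr k) P"
  shows "skew (mcomm v P)"
  using assms by (auto simp: tangent_space_Gr Gr_iff herm_projD(4) skew_mcomm)

text \<open>The acceleration [K, [K, g]] commutes with \<open>g\<close>, while a tangent vector is a
  commutator with \<open>g\<close>. By symmetry of commutation with \<open>g\<close> the two are
  orthogonal.\<close>

lemma geodesic_rot:
  assumes P: "P \<in> Gr k" and v: "v \<in> tangent_space (Gr k) P"
  shows "geodesic (Gr k) (\<lambda>t. rot (t *\<^sub>R mcomm v P) P)"
proof -
  define K where "K = mcomm v P"
  have K: "skew K" using skew_tangent[OF P v] by (simp add: K_def)
  define g where "g t = rot (t *\<^sub>R K) P" for t
  have g: "g t \<in> Gr k" for t
    using rot_in_Gr[OF skew_scaleR[OF K] P] by (simp add: g_def)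
  have d1: "(g has_vector_derivative mcomm K (g t)) (at t)" for t
    unfolding g_def by (rule rot_has_vector_derivative[OF K])
  have vd1: "vector_derivative g (at s) = mcomm K (g s)" for s
    by (rule vector_derivative_at[OF d1])
  have d2: "((\<lambda>s. mcomm K (g s)) has_vector_derivative mcomm K (mcomm K (g t))) (at t)" for t
    by (rule bounded_linear.has_vector_derivative[OF bounded_bilinear.bounded_linear_right[OF bounded_bilinear_mcomm] d1])
  have "mcomm K (mcomm K (g t)) \<bullet> w = 0" if w: "w \<in> tangent_space (Gr k) (g t)" for t w
  proof -
    \<comment> \<open>The constant curve \<open>K\<close> solves the flow equation of
      \<open>K\<close>. Conjugating [[K, P], P] = K by the flow therefore gives the same relation at
      \<open>g t\<close>.\<close>
    have "rot (t *\<^sub>R K) K = K"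
      using rot_unique[OF K, of "\<lambda>_. K" t] by (simp add: mcomm_simps)
    moreover have "mcomm (mcomm K P) P = K"
      using v P by (simp add: tangent_space_Gr K_def)
    ultimately have "mcomm (mcomm K (g t)) (g t) = K"
      by (metis g_def rot_mcomm skew_scaleR[OF K])
    then have *: "mcomm (mcomm K (mcomm K (g t))) (g t) = 0"
      using g[of t] acceleration_commutes[of "g t" K] by (simp add: Gr_iff)
    have "w = mcomm (mcomm w (g t)) (g t)"
      using w g by (simp add: tangent_space_Gr)
    then have "mcomm K (mcomm K (g t)) \<bullet> w = mcomm (mcomm K (mcomm K (g t))) (g t) \<bullet> mcomm w (g t)"
      using g[of t] by (metis Gr_iff herm_projD(4) inner_mcomm)
    then show ?thesis by (simp add: *)
  qed
  then have "tangent_proj (Gr k) (g t) (vector_derivative (\<lambda>s. vector_derivative g (at s)) (at t)) = 0" for t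
    unfolding vd1 vector_derivative_at[OF d2]
    by (subst tangent_proj_eq_0_iff[OF subspace_tangent_space_Gr[OF g]]) auto
  moreover have "smooth_on UNIV g"
    unfolding g_def by (rule smooth_on_rot[OF K])
  ultimately have "geodesic (Gr k) g"
    using g by (auto simp: geodesic_def)
  then show ?thesis unfolding g_def[abs_def] K_def .
qed

text \<open>Along a geodesic \<open>g\<close> the commutator \<open>[g', g]\<close> is conserved, because \<open>g''\<close> is normal and hence
  commutes with \<open>g\<close>. So \<open>g\<close> solves a linear equation.\<close>

lemma geodesic_eq_rot:
  assumes g: "geodesic (Gr k) g" and v: "(g has_vector_derivative v) (at 0)"
  shows "g t = rot (t *\<^sub>R mcomm v (g 0)) (g 0)"
proof -
  define g1 where "g1 = (\<lambda>s. vector_derivative g (at s))"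
  define g2 where "g2 = (\<lambda>s. vector_derivative g1 (at s))"
  have sm: "smooth_on UNIV g" and gGr: "g s \<in> Gr k" for s
    using g by (auto simp: geodesic_def)
  have d1: "(g has_vector_derivative g1 s) (at s)" and d2: "(g1 has_vector_derivative g2 s) (at s)" for s
    using smooth_on_UNIV_vector_derivative[OF sm] by (simp_all add: g1_def g2_def)
  have gp: "herm_proj (g s)" for s
    using gGr[of s] by (simp add: Gr_iff)
  have g1t: "conj_transpose (g1 s) = g1 s" "mcomm (mcomm (g1 s) (g s)) (g s) = g1 s" for s
    using herm_proj_velocity[OF d1 open_UNIV] gp by auto
  have "((\<lambda>s. conj_transpose (g1 s)) has_vector_derivative conj_transpose (g2 s)) (at s)" for s
    by (rule has_vector_derivative_conj_transpose[OF d2])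
  then have g2h: "conj_transpose (g2 s) = g2 s" for s
    using vector_derivative_unique_at d2 unfolding g1t(1) by blast
  have normal: "mcomm (g2 s) (g s) = 0" for s
  proof -
    have "tangent_proj (Gr k) (g s) (g2 s) = 0"
      using g by (simp add: geodesic_def g2_def g1_def)
    then have perp: "\<forall>w\<in>tangent_space (Gr k) (g s). g2 s \<bullet> w = 0"
      unfolding tangent_proj_eq_0_iff[OF subspace_tangent_space_Gr[OF gGr[of s]]] .
    \<comment> \<open>The tangent vector tested against \<open>g2 s\<close> is its own double
      commutator; the resulting product is the squared norm of [g'', g].\<close>
    have "mcomm (mcomm (g2 s) (g s)) (g s) \<in> tangent_space (Gr k) (g s)"
      by (simp add: tangent_space_Gr[OF gGr] conj_transpose_mcomm herm_projD[OF gp] g2h mcomm_cube[OF gp])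
        (simp add: mcomm_anticommute[of "g s"] mcomm_simps)
    with perp have "g2 s \<bullet> mcomm (mcomm (g2 s) (g s)) (g s) = 0" by blast
    moreover have "mcomm (g2 s) (g s) \<bullet> mcomm (g2 s) (g s) = g2 s \<bullet> mcomm (mcomm (g2 s) (g s)) (g s)"
      by (subst inner_mcomm) (simp add: herm_projD[OF gp])
    ultimately show ?thesis by simp
  qed
  let ?K = "\<lambda>s. mcomm (g1 s) (g s)"
  have "(?K has_vector_derivative 0) (at s)" for s
    using bounded_bilinear.has_vector_derivative[OF bounded_bilinear_mcomm d2[of s] d1[of s]] normal[of s]
    by simp
  from has_vector_derivative_zero_const[of ?K, OF this] have K: "?K s = ?K 0" for s .
  have g10: "g1 0 = v"
    using vector_derivative_at[OF v] by (simp add: g1_def)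
  \<comment> \<open>Tangency gives g' = [[g', g], g], and the inner commutator has its initial
    value, so \<open>rot_unique\<close> applies.\<close>
  have "(g has_vector_derivative mcomm (mcomm v (g 0)) (g s)) (at s)" for s
    using d1[of s] g1t(2)[of s] K[of s] g10 by simp
  moreover have "skew (mcomm v (g 0))"
    using g1t(1)[of 0] g10 gp[of 0] by (simp add: skew_mcomm herm_projD)
  ultimately show ?thesis
    using rot_unique by blast
qed

text \<open>\<open>geodesic_rot\<close> provides the geodesic and \<open>geodesic_eq_rot\<close>
  shows that it is the only one, so the definite description in \<open>Exp\<close> has a
  value.\<close>

lemma Exp_Gr:
  assumes P: "P \<in> Gr k" and v: "v \<in> tangent_space (Gr k) P"
  shows "Exp (Gr k) P v = rot (mcomm v P) P"
  unfolding Exp_def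
proof (rule the_equality)
  let ?g = "\<lambda>t. rot (t *\<^sub>R mcomm v P) P"
  have "(?g has_vector_derivative v) (at 0)"
    using rot_has_vector_derivative[OF skew_tangent[OF P v], of P 0] v P
    by (simp add: tangent_space_Gr)
  with geodesic_rot[OF P v] show "\<exists>g. geodesic (Gr k) g \<and> g 0 = P \<and>
      (g has_vector_derivative v) (at 0) \<and> g 1 = rot (mcomm v P) P"
    by (intro exI[of _ ?g]) auto
next
  fix Q assume "\<exists>g. geodesic (Gr k) g \<and> g 0 = P \<and> (g has_vector_derivative v) (at 0) \<and> g 1 = Q"
  then show "Q = rot (mcomm v P) P"
    using geodesic_eq_rot[of k _ v 1] by auto
qed

section \<open>Discrete geodesics\<close>

text \<open>In the direction K = [S, P] the derivative of the product with \<open>S\<close> is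
  |K|^2, which must vanish at a maximum.\<close>

lemma critical_point_commutes:
  fixes P S :: "'f::real_or_complex^'n^'n"
  assumes P: "conj_transpose P = P" and S: "conj_transpose S = S"
    and max: "\<And>K. skew K \<Longrightarrow> rot K P \<bullet> S \<le> P \<bullet> S"
  shows "mcomm S P = 0"
proof -
  define K where "K = mcomm S P"
  have K: "skew K" using S P by (simp add: K_def skew_mcomm)
  have "((\<lambda>t. rot (t *\<^sub>R K) P \<bullet> S) has_vector_derivative mcomm K P \<bullet> S) (at 0)"
    using bounded_linear.has_vector_derivative[OF bounded_linear_inner_left rot_has_vector_derivative[OF K, of P 0], of S]
    by simp
  then have "((\<lambda>t. rot (t *\<^sub>R K) P \<bullet> S) has_real_derivative mcomm K P \<bullet> S) (at 0)"
    by (simp add: has_real_derivative_iff_has_vector_derivative)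
  then have "mcomm K P \<bullet> S = 0"
    by (rule DERIV_local_max[where d = 1]) (use max[OF skew_scaleR[OF K]] in auto)
  moreover have "mcomm K P \<bullet> S = K \<bullet> K"
    by (simp add: inner_mcomm P K_def)
  ultimately show ?thesis by (simp add: K_def)
qed

definition chain_energy :: "nat \<Rightarrow> (nat \<Rightarrow> 'a::real_normed_vector) \<Rightarrow> real" where
  "chain_energy N p = (\<Sum>i<N. (norm (p (Suc i) - p i))\<^sup>2)"

text \<open>Only the two summands that involve the moved point change.\<close>

lemma chain_energy_update:
  assumes "Suc m < N"
  shows "chain_energy N (p(Suc m := r)) - chain_energy N p =
    ((norm (r - p m))\<^sup>2 + (norm (p (Suc (Suc m)) - r))\<^sup>2)
    - ((norm (p (Suc m) - p m))\<^sup>2 + (norm (p (Suc (Suc m)) - p (Suc m)))\<^sup>2)"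
proof -
  let ?q = "p(Suc m := r)"
  let ?f = "\<lambda>i. (norm (?q (Suc i) - ?q i))\<^sup>2 - (norm (p (Suc i) - p i))\<^sup>2"
  have "chain_energy N ?q - chain_energy N p = sum ?f {..<N}"
    by (simp add: chain_energy_def sum_subtractf)
  also have "\<dots> = sum ?f {m, Suc m}"
    by (rule sum.mono_neutral_right) (use assms in auto)
  finally show ?thesis by simp
qed

text \<open>In an energy minimizing chain the sum of the neighbours of an inner point is normal at that
  point, hence commutes with it: the commutator of successive points is a discrete analogue of the
  quantity conserved along geodesics.\<close>

lemma minimal_chain:
  fixes P Q :: "'f::real_or_complex^'n^'n"
  assumes N: "N > 0" and p0: "\<And>i. p0 i \<in> Gr k"
  obtains p where "\<And>i. p i \<in> Gr k" "p 0 = p0 0" "p N = p0 N" "chain_energy N p \<le> chain_energy N p0"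
    "\<And>i. i < N \<Longrightarrow> mcomm (p (Suc i)) (p i) = (mcomm (p 1) (p 0) :: 'f^'n^'n)"
proof -
  \<comment> \<open>Chains are functions on all naturals, with pinned values at 0 and
    \<open>N\<close>, so that the set of competitors is a product of compact sets and Tychonoff
    gives a minimizer.\<close>
  let ?A = "\<lambda>i. if i = 0 \<or> i = N then {p0 i} else Gr k"
  define S where "S = PiE UNIV ?A"
  have "p \<in> S \<longleftrightarrow> (\<forall>i. p i \<in> ?A i)" for p
    unfolding S_def PiE_UNIV_domain by blast
  then have S: "p \<in> S \<longleftrightarrow> (\<forall>i. p i \<in> Gr k) \<and> p 0 = p0 0 \<and> p N = p0 N" for p
    using p0 by (smt (verit) singletonD singletonI)
  have "compactin (product_topology (\<lambda>i. euclidean) UNIV) S"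
    unfolding S_def compactin_PiE by (auto simp: compact_Gr)
  then have "compact S"
    by (simp add: euclidean_product_topology)
  moreover have "p0 \<in> S"
    using p0 by (simp add: S)
  moreover have "continuous_on S (chain_energy N)"
    unfolding chain_energy_def
    by (intro continuous_intros continuous_on_product_then_coordinatewise continuous_on_id)
  ultimately obtain p where p: "p \<in> S" and min: "\<And>q. q \<in> S \<Longrightarrow> chain_energy N p \<le> chain_energy N q"
    using continuous_attains_inf[of S "chain_energy N"] by blast
  have pGr: "p i \<in> Gr k" for i
    using p by (simp add: S)
  have herm: "conj_transpose (p i) = p i" for i
    using pGr[of i] by (simp add: Gr_iff herm_projD)
  have step: "mcomm (p (Suc (Suc m))) (p (Suc m)) = mcomm (p (Suc m)) (p m)" if m: "Suc m < N" for m
  proof -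
    let ?T = "p m + p (Suc (Suc m))"
    have "mcomm ?T (p (Suc m)) = 0"
    proof (rule critical_point_commutes)
      fix K :: "'f^'n^'n" assume K: "skew K"
      let ?r = "rot K (p (Suc m))"
      have "p(Suc m := ?r) \<in> S"
        using p rot_in_Gr[OF K pGr[of "Suc m"]] m by (auto simp: S)
      then have "0 \<le> chain_energy N (p(Suc m := ?r)) - chain_energy N p"
        using min by simp
      \<comment> \<open>Rotation keeps the norm of the inner point, so minimal energy means maximal
        product with the sum of the two neighbours.\<close>
      also have "\<dots> = 2 * ((norm ?r)\<^sup>2 - (norm (p (Suc m)))\<^sup>2) - 2 * (?r \<bullet> ?T) + 2 * (p (Suc m) \<bullet> ?T)"
        unfolding chain_energy_update[OF m]
        by (simp add: power2_norm_eq_inner inner_diff_left inner_diff_right inner_add_right inner_commute)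
      finally show "?r \<bullet> ?T \<le> p (Suc m) \<bullet> ?T"
        by (simp add: norm_rot[OF K])
    qed (simp_all add: herm conj_transpose_add)
    then show ?thesis
      by (simp add: mcomm_simps mcomm_anticommute[of "p (Suc m)" "p m"] add_eq_0_iff)
  qed
  have const: "mcomm (p (Suc i)) (p i) = mcomm (p 1) (p 0)" if "i < N" for i
    using that by (induction i) (simp_all add: step)
  show ?thesis
    using that[OF pGr _ _ min[OF \<open>p0 \<in> S\<close>] const] p N by (simp add: S)
qed

text \<open>The constant \<open>C\<close> depends neither on the chain nor on \<open>N\<close> and
  \<open>l\<close>. For the minimal chain, N |K|^2 is at most its energy, which is at most l^2 / N,
  so N K has norm at most \<open>l\<close>; the Newton errors of the \<open>N\<close> steps sum to
  at most \<open>C\<close> times the energy.\<close>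

lemma rot_approx_chain:
  obtains C where "C \<ge> 0" and
    "\<And>k (N::nat) p l. N > 0 \<Longrightarrow> (\<And>i. p i \<in> (Gr k :: ('f::real_or_complex^'n^'n) set)) \<Longrightarrow>
      (\<And>i. i < N \<Longrightarrow> norm (p (Suc i) - p i) \<le> l / N) \<Longrightarrow>
      \<exists>K. skew K \<and> mcomm (mcomm K (p 0)) (p 0) = K \<and> norm K \<le> l \<and> norm (rot K (p 0) - p N) \<le> C * l\<^sup>2 / N"
proof -
  obtain C where C: "C \<ge> 0" "\<And>P Q. herm_proj P \<Longrightarrow> herm_proj Q \<Longrightarrow>
       norm (rot (mcomm Q P) P - (Q :: 'f^'n^'n)) \<le> C * (norm (Q - P))\<^sup>2"
    using rot_newton by blast
  show ?thesis
  proof (rule that[OF C(1)])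
    fix k N :: nat and l :: real and p0 :: "nat \<Rightarrow> 'f^'n^'n"
    assume N: "N > 0" and p0: "\<And>i. p0 i \<in> Gr k"
      and l: "\<And>i. i < N \<Longrightarrow> norm (p0 (Suc i) - p0 i) \<le> l / N"
    have l0: "l \<ge> 0"
      using order_trans[OF norm_ge_zero l[OF N]] N by (simp add: zero_le_divide_iff)
    have "chain_energy N p0 \<le> (\<Sum>i<N. (l / N)\<^sup>2)"
      unfolding chain_energy_def by (intro sum_mono power_mono l) auto
    also have "\<dots> = l\<^sup>2 / N"
      using N by (simp add: power2_eq_square)
    finally have E0: "chain_energy N p0 \<le> l\<^sup>2 / N" .
    obtain p where p: "\<And>i. p i \<in> Gr k" "p 0 = p0 0" "p N = p0 N" "chain_energy N p \<le> chain_energy N p0"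
      "\<And>i. i < N \<Longrightarrow> mcomm (p (Suc i)) (p i) = mcomm (p 1) (p 0)"
      using minimal_chain[of N p0 k, OF N p0] by blast
    have E: "chain_energy N p \<le> l\<^sup>2 / N"
      using p(4) E0 by simp
    define K where "K = mcomm (p 1) (p 0)"
    have proj: "herm_proj (p i)" for i
      using p(1)[of i] by (simp add: Gr_iff)
    have K: "skew K"
      by (simp add: K_def skew_mcomm herm_projD[OF proj])
    have normK: "norm K \<le> norm (p (Suc i) - p i)" if "i < N" for i
      using norm_mcomm_le[OF proj, of "p (Suc i) - p i" i] p(5)[OF that] by (simp add: mcomm_simps K_def)
    have "(\<Sum>i<N. (norm K)\<^sup>2) \<le> chain_energy N p"
      unfolding chain_energy_def by (intro sum_mono power_mono normK) auto
    then have "real N * (norm K)\<^sup>2 \<le> l\<^sup>2 / N"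
      using E by simp
    then have "(N * norm K)\<^sup>2 \<le> l\<^sup>2"
      using N by (simp add: field_simps power2_eq_square)
    then have 1: "norm (real N *\<^sub>R K) \<le> l"
      using l0 by (simp add: power2_le_iff_abs_le)
    \<comment> \<open>By induction on \<open>i\<close>: \<open>rot K\<close> preserves the error
      made so far, and going from \<open>p i\<close> to the next point is the step of
      \<open>rot_newton\<close> with the same generator \<open>K\<close>.\<close>
    have "norm (rot (real i *\<^sub>R K) (p 0) - p i) \<le> C * (\<Sum>j<i. (norm (p (Suc j) - p j))\<^sup>2)" if "i \<le> N" for i
      using that
    proof (induction i)
      case (Suc i)
      have "rot (real (Suc i) *\<^sub>R K) (p 0) = rot K (rot (real i *\<^sub>R K) (p 0))"
        using rot_add[OF K, of 1 "real i"] by simp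
      then have "norm (rot (real (Suc i) *\<^sub>R K) (p 0) - p (Suc i)) \<le>
          norm (rot K (rot (real i *\<^sub>R K) (p 0)) - rot K (p i)) + norm (rot K (p i) - p (Suc i))"
        using norm_triangle_ineq[of "rot K (rot (real i *\<^sub>R K) (p 0)) - rot K (p i)" "rot K (p i) - p (Suc i)"] by simp
      also have "\<dots> \<le> C * (\<Sum>j<i. (norm (p (Suc j) - p j))\<^sup>2) + C * (norm (p (Suc i) - p i))\<^sup>2"
        using Suc C(2)[OF proj[of i] proj[of "Suc i"]] p(5)[of i, folded K_def]
        by (intro add_mono) (simp_all add: rot_isometric[OF K])
      finally show ?case by (simp add: algebra_simps)
    qed simp
    from this[of N] have "norm (rot (real N *\<^sub>R K) (p 0) - p N) \<le> C * chain_energy N p"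
      by (simp add: chain_energy_def)
    also have "\<dots> \<le> C * (l\<^sup>2 / N)"
      using E C(1) by (rule mult_left_mono)
    finally have 2: "norm (rot (real N *\<^sub>R K) (p0 0) - p0 N) \<le> C * l\<^sup>2 / N"
      using p by simp
    \<comment> \<open>The witness is N K; it is off-diagonal at the starting point because
      \<open>K\<close> is a commutator with that point.\<close>
    show "\<exists>K. skew K \<and> mcomm (mcomm K (p0 0)) (p0 0) = K \<and> norm K \<le> l \<and>
        norm (rot K (p0 0) - p0 N) \<le> C * l\<^sup>2 / N"
      using 1 2 skew_scaleR[OF K] mcomm_cube[OF proj[of 0], of "p 1"] p(2)
      by (intro exI[of _ "real N *\<^sub>R K"]) (simp add: mcomm_simps K_def)
  qed
qed

text \<open>Bounded generators have a convergent subsequence, and \<open>rot_lipschitz\<close> makes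
  \<open>rot\<close> continuous in the generator.\<close>

lemma rot_compactness:
  fixes P Q :: "'f::real_or_complex^'n^'n"
  assumes P: "herm_proj P" and K: "\<And>n. skew (K n)" "bounded (range K)"
    and Q: "(\<lambda>n. rot (K n) P) \<longlonglongrightarrow> Q"
  obtains K0 and r :: "nat \<Rightarrow> nat" where "strict_mono r" "(\<lambda>n. K (r n)) \<longlonglongrightarrow> K0" "skew K0" "rot K0 P = Q"
proof -
  obtain K0 r where r: "strict_mono r" and "(K \<circ> r) \<longlonglongrightarrow> K0"
    using bounded_imp_convergent_subsequence[OF K(2)] by blast
  then have lim: "(\<lambda>n. K (r n)) \<longlonglongrightarrow> K0" by (simp add: o_def)
  have "(\<lambda>n. conj_transpose (K (r n))) \<longlonglongrightarrow> conj_transpose K0"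
    by (rule bounded_linear.tendsto[OF bounded_linear_conj_transpose lim])
  moreover have "(\<lambda>n. conj_transpose (K (r n))) \<longlonglongrightarrow> - K0"
    using tendsto_minus[OF lim] K(1) by (simp add: skew_def)
  ultimately have skew: "skew K0"
    unfolding skew_def by (rule LIMSEQ_unique)
  have "(\<lambda>n. norm (K (r n) - K0)) \<longlonglongrightarrow> 0"
    using lim by (simp add: LIM_zero tendsto_norm_zero)
  then have "(\<lambda>n. rot (K (r n)) P - rot K0 P) \<longlonglongrightarrow> 0"
    by (rule Lim_null_comparison[rotated]) (simp add: rot_lipschitz[OF P K(1) skew])
  then have "(\<lambda>n. rot (K (r n)) P) \<longlonglongrightarrow> rot K0 P"
    by (rule LIM_zero_cancel)
  moreover have "(\<lambda>n. rot (K (r n)) P) \<longlonglongrightarrow> Q"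
    using LIMSEQ_subseq_LIMSEQ[OF Q r] by (simp add: o_def)
  ultimately have "rot K0 P = Q"
    by (rule LIMSEQ_unique)
  with r lim skew that show thesis by blast
qed

text \<open>The bound \<open>l\<close> may vary with the number of steps, so that the chains can
  come from paths whose lengths merely approach the infimum \<open>L\<close>. The errors of order
  1/N vanish in the limit and \<open>rot_compactness\<close> yields the generator.\<close>

lemma rot_of_chains:
  fixes P Q :: "'f::real_or_complex^'n^'n"
  assumes P: "P \<in> Gr k" and l: "l \<longlonglongrightarrow> L"
    and chains: "\<And>N. N > 0 \<Longrightarrow> \<exists>p. (\<forall>i. p i \<in> Gr k) \<and> p 0 = P \<and> p N = Q \<and>
      (\<forall>i<N. norm (p (Suc i) - p i) \<le> l N / N)"
  obtains K where "skew K" "mcomm (mcomm K P) P = K" "norm K \<le> L" "rot K P = Q"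
proof -
  obtain C where C: "C \<ge> 0"
    "\<And>k (N::nat) p l. N > 0 \<Longrightarrow> (\<And>i. p i \<in> (Gr k :: ('f^'n^'n) set)) \<Longrightarrow>
      (\<And>i. i < N \<Longrightarrow> norm (p (Suc i) - p i) \<le> l / N) \<Longrightarrow>
      \<exists>K. skew K \<and> mcomm (mcomm K (p 0)) (p 0) = K \<and> norm K \<le> l \<and> norm (rot K (p 0) - p N) \<le> C * l\<^sup>2 / N"
    using rot_approx_chain by blast
  have "\<exists>K. skew K \<and> mcomm (mcomm K P) P = K \<and> norm K \<le> l (Suc n) \<and>
      norm (rot K P - Q) \<le> C * (l (Suc n))\<^sup>2 / Suc n" for n
  proof -
    obtain p where "\<And>i. p i \<in> Gr k" "p 0 = P" "p (Suc n) = Q"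
      "\<And>i. i < Suc n \<Longrightarrow> norm (p (Suc i) - p i) \<le> l (Suc n) / Suc n"
      using chains[of "Suc n"] by auto
    then show ?thesis
      using C(2)[of "Suc n" p k "l (Suc n)"] by auto
  qed
  then obtain K where K: "\<And>n. skew (K n)" "\<And>n. mcomm (mcomm (K n) P) P = K n" "\<And>n. norm (K n) \<le> l (Suc n)"
    "\<And>n. norm (rot (K n) P - Q) \<le> C * (l (Suc n))\<^sup>2 / Suc n"
    by metis
  obtain B where B: "\<And>n. l n \<le> B"
    using convergent_imp_Bseq[OF convergentI[OF l]] unfolding Bseq_def by (metis abs_le_D1 real_norm_def)
  have bounded: "bounded (range K)"
    unfolding bounded_iff using K(3) B by (intro exI[of _ B]) (auto intro: order_trans)
  have "(\<lambda>n. C * (l (Suc n))\<^sup>2 * inverse (Suc n)) \<longlonglongrightarrow> C * L\<^sup>2 * 0"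
    using LIMSEQ_Suc[OF l] LIMSEQ_inverse_real_of_nat by (intro tendsto_intros)
  then have "(\<lambda>n. rot (K n) P - Q) \<longlonglongrightarrow> 0"
    by (intro Lim_null_comparison[of "\<lambda>n. rot (K n) P - Q"] always_eventually allI)
      (use K(4) in \<open>simp_all add: divide_inverse\<close>)
  then have "(\<lambda>n. rot (K n) P) \<longlonglongrightarrow> Q"
    by (rule LIM_zero_cancel)
  then obtain K0 r where r: "strict_mono r" and lim: "(\<lambda>n. K (r n)) \<longlonglongrightarrow> K0"
      and skew: "skew K0" and Q: "rot K0 P = Q"
    using rot_compactness[of P K Q] P K(1) bounded by (metis Gr_iff)
  have Sr: "strict_mono (\<lambda>n. Suc (r n))" using r by (simp add: strict_mono_def)
  have lr: "(\<lambda>n. l (Suc (r n))) \<longlonglongrightarrow> L"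
    using LIMSEQ_subseq_LIMSEQ[OF l Sr] by (simp add: o_def)
  have "(\<lambda>n. mcomm (mcomm (K (r n)) P) P) \<longlonglongrightarrow> mcomm (mcomm K0 P) P"
    by (intro bounded_bilinear.tendsto[OF bounded_bilinear_mcomm] lim tendsto_const)
  then have off: "mcomm (mcomm K0 P) P = K0"
    unfolding K(2) using lim by (rule LIMSEQ_unique)
  have norm: "norm K0 \<le> L"
    by (rule LIMSEQ_le[OF tendsto_norm[OF lim] lr]) (use K(3) in auto)
  with skew Q off that show thesis by blast
qed

lemma rot_of_lipschitz_path:
  fixes F :: "real \<Rightarrow> 'f::real_or_complex^'n^'n"
  assumes F: "\<And>t. F t \<in> Gr k" and lip: "\<And>s t. norm (F s - F t) \<le> L * \<bar>s - t\<bar>"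
  obtains K where "skew K" "mcomm (mcomm K (F 0)) (F 0) = K" "norm K \<le> L" "rot K (F 0) = F 1"
proof (rule rot_of_chains[OF F[of 0] tendsto_const[of L], of "F 1"])
  fix N :: nat assume N: "N > 0"
  have "norm (F (real (Suc i) / N) - F (real i / N)) \<le> L / N" for i
    using lip[of "real (Suc i) / N" "real i / N"] by (simp flip: diff_divide_distrib)
  then show "\<exists>p. (\<forall>i. p i \<in> Gr k) \<and> p 0 = F 0 \<and> p N = F 1 \<and>
      (\<forall>i<N. norm (p (Suc i) - p i) \<le> L / N)"
    using F N by (intro exI[of _ "\<lambda>i. F (real i / N)"]) auto
qed (use that in blast)

text \<open>Equivalently, \<open>Exp\<^sub>P\<close> does not increase distances.\<close>

lemma rot_hinge:
  fixes P :: "'f::real_or_complex^'n^'n"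
  assumes P: "P \<in> Gr k" and K: "skew K" and L: "skew L"
  obtains J where "skew J" "norm J \<le> norm (K - L)" "rot J (rot K P) = rot L P"
proof -
  \<comment> \<open>The image of the segment from \<open>K\<close> to \<open>L\<close> is a path
    from \<open>rot K P\<close> to \<open>rot L P\<close>, and \<open>rot_lipschitz\<close> makes it
    Lipschitz with constant |K - L|.\<close>
  define F where "F t = rot (K + t *\<^sub>R (L - K)) P" for t :: real
  have sk: "skew (K + t *\<^sub>R (L - K))" for t
    by (intro skew_add skew_scaleR skew_diff K L)
  have "norm (F s - F t) \<le> norm (K - L) * \<bar>s - t\<bar>" for s t
  proof -
    have "norm (F s - F t) \<le> norm ((K + s *\<^sub>R (L - K)) - (K + t *\<^sub>R (L - K)))"
      unfolding F_def using P by (intro rot_lipschitz sk) (simp add: Gr_iff)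
    also have "(K + s *\<^sub>R (L - K)) - (K + t *\<^sub>R (L - K)) = (s - t) *\<^sub>R (L - K)"
      by (simp add: algebra_simps)
    finally show ?thesis by (simp add: norm_minus_commute mult.commute)
  qed
  moreover have "F t \<in> Gr k" for t
    unfolding F_def by (intro rot_in_Gr sk P)
  ultimately obtain J where "skew J" "norm J \<le> norm (K - L)" "rot J (F 0) = F 1"
    using rot_of_lipschitz_path[of F k "norm (K - L)"] by metis
  then show thesis using that by (simp add: F_def)
qed

text \<open>This is the hinge at the middle point \<open>rot K P\<close>, with - K leading back to
  \<open>P\<close> and \<open>L\<close> leading on.\<close>

lemma rot_comp:
  fixes P :: "'f::real_or_complex^'n^'n"
  assumes P: "P \<in> Gr k" and K: "skew K" and L: "skew L"
  obtains J where "skew J" "norm J \<le> norm K + norm L" "rot J P = rot L (rot K P)"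
proof -
  obtain J where "skew J" "norm J \<le> norm (- K - L)" "rot J (rot (- K) (rot K P)) = rot L (rot K P)"
    using rot_hinge[OF rot_in_Gr[OF K P] skew_minus[OF K] L] by blast
  moreover have "norm (- K - L) \<le> norm K + norm L"
    using norm_triangle_ineq4[of "- K" L] by simp
  ultimately show thesis
    using that rot_minus_cancel[OF K] by (metis order_trans)
qed

section \<open>Connectedness of the Grassmannian\<close>

text \<open>PQ = P puts the row space of \<open>P\<close> inside that of \<open>Q\<close>, and equal
  rank makes them equal. Then \<open>P\<close> fixes the rows of \<open>Q\<close>, so QP = Q, and
  taking adjoints gives P = Q.\<close>

lemma herm_proj_eq_if_absorbs:
  fixes P Q :: "'f::real_or_complex^'n^'n"
  assumes P: "herm_proj P" and Q: "herm_proj Q" and rank: "rank P = rank Q" and PQ: "P ** Q = P"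
  shows "P = Q"
proof -
  let ?fix = "{x. x v* P = x}"
  have sub: "vec.subspace ?fix"
    by (simp add: vec.subspace_def vector_matrix_mult_def vec_eq_iff distrib_left distrib_right sum.distrib)
      (simp add: mult.assoc mult.left_commute flip: sum_distrib_left)
  have row_mult: "row i (A ** B) = row i A v* B" for i and A B :: "'f^'n^'n"
    by (simp add: row_def matrix_matrix_mult_def vector_matrix_mult_def vec_eq_iff mult.commute)
  have "rows P \<subseteq> vec.span (rows Q)"
    using rows_mult_subset[of P Q] by (simp add: PQ)
  moreover have "vec.dim (vec.span (rows Q)) \<le> vec.dim (rows P)"
    using rank by (simp add: row_rank_def_gen)
  ultimately have "vec.span (rows P) = vec.span (vec.span (rows Q))"
    by (rule vec.dim_eq_span)
  moreover have "rows P \<subseteq> ?fix"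
    by (auto simp: rows_def row_mult[symmetric] herm_projD[OF P])
  then have "vec.span (rows P) \<subseteq> ?fix"
    using sub by (rule vec.span_minimal)
  ultimately have "rows Q \<subseteq> ?fix"
    using vec.span_superset by (metis subset_trans vec.span_span)
  then have "row i (Q ** P) = row i Q" for i
    unfolding row_mult by (auto simp: rows_def)
  then have "Q ** P = Q"
    by (simp add: row_def vec_eq_iff)
  then have "conj_transpose (Q ** P) = conj_transpose Q" by simp
  then show ?thesis
    by (simp add: conj_transpose_mult herm_projD[OF P] herm_projD[OF Q] PQ)
qed

text \<open>The witness is the matrix unit that links a nonzero entry of \<open>F\<close> to one of
  \<open>E\<close>.\<close>

lemma matrix_sandwich_nonzero:
  fixes E F :: "'f::field^'n^'n"
  assumes "E \<noteq> 0" "F \<noteq> 0"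
  obtains W where "F ** W ** E \<noteq> 0"
proof -
  obtain a b c d where nz: "E $ a $ b \<noteq> 0" "F $ c $ d \<noteq> 0"
    using assms by (auto simp: vec_eq_iff)
  define W :: "'f^'n^'n" where "W = (\<chi> i j. if i = d \<and> j = a then 1 else 0)"
  have "(F ** W) $ c $ j = (if j = a then F $ c $ d else 0)" for j
    by (simp add: matrix_matrix_mult_def W_def if_distrib[of "\<lambda>x. _ * x"] cong: if_cong)
  then have "(F ** W ** E) $ c $ b = F $ c $ d * E $ a $ b"
    by (simp add: matrix_matrix_mult_def[of "F ** W"] if_distrib[of "\<lambda>x. x * _"] cong: if_cong)
  with nz have "F ** W ** E \<noteq> 0"
    by (metis mult_eq_0_iff zero_index)
  then show thesis by (rule that)
qed

text \<open>Commuting projections \<open>R\<close>, \<open>Q\<close> form a critical point of \<open>R \<bullet> Q\<close>; the rotation moves the part of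
  the range of \<open>R\<close> orthogonal to that of \<open>Q\<close> into the range of \<open>Q\<close>, and makes the second
  derivative positive.\<close>

lemma commuting_improvement:
  fixes R Q :: "'f::real_or_complex^'n^'n"
  assumes R: "herm_proj R" and Q: "herm_proj Q" and rank: "rank R = rank Q" and neq: "R \<noteq> Q"
    and comm: "Q ** R = R ** Q"
  obtains K where "skew K" "R \<bullet> Q < rot K R \<bullet> Q"
proof -
  note [simp] = herm_projD[OF R] herm_projD[OF Q]
  \<comment> \<open>\<open>E\<close> projects onto the part of the range of \<open>R\<close>
    orthogonal to that of \<open>Q\<close>, and \<open>F\<close> does so with the roles exchanged.
    \<open>T\<close> below maps the first part into the second.\<close>
  define E where "E = R - R ** Q"
  define F where "F = Q - R ** Q"
  have "E \<noteq> 0"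
    using herm_proj_eq_if_absorbs[OF R Q rank] neq by (auto simp: E_def)
  moreover have "F \<noteq> 0"
    using herm_proj_eq_if_absorbs[OF Q R rank[symmetric]] neq comm by (auto simp: F_def)
  ultimately obtain W where W: "F ** W ** E \<noteq> 0"
    by (rule matrix_sandwich_nonzero)
  define T where "T = F ** W ** E"
  have comm': "X ** Q ** R = X ** R ** Q" for X
    by (metis comm matrix_mul_assoc)
  have "E ** R = E" "E ** Q = 0" "R ** F = 0" "Q ** F = F" "E ** F = 0"
    unfolding E_def F_def matrix_distribs matrix_mul_assoc by (simp_all add: comm comm')
  then have T: "T ** R = T" "T ** Q = 0" "R ** T = 0" "Q ** T = T" "T ** T = 0"
    by (simp_all add: T_def matrix_mul_assoc) (simp_all add: matrix_mul_assoc[symmetric])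
  define T' where "T' = conj_transpose T"
  have T': "R ** T' = T'" "Q ** T' = 0" "T' ** R = 0" "T' ** T' = 0"
    using T[THEN arg_cong[of _ _ conj_transpose]] by (simp_all add: conj_transpose_mult T'_def)
  define K where "K = T - T'"
  have K: "skew K"
    by (simp add: skew_def K_def T'_def conj_transpose_simps)
  define f where "f t = rot (t *\<^sub>R K) R \<bullet> Q" for t
  define f1 where "f1 t = mcomm K (rot (t *\<^sub>R K) R) \<bullet> Q" for t
  have f: "(f has_real_derivative f1 t) (at t)" for t
    unfolding f_def f1_def has_real_derivative_iff_has_vector_derivative
    by (rule bounded_linear.has_vector_derivative[OF bounded_linear_inner_left rot_has_vector_derivative[OF K]])
  have "(f1 has_real_derivative mcomm K (mcomm K (rot (0 *\<^sub>R K) R)) \<bullet> Q) (at 0)"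
    unfolding f1_def has_real_derivative_iff_has_vector_derivative
    by (rule bounded_linear.has_vector_derivative[OF bounded_linear_inner_left
        bounded_linear.has_vector_derivative[OF bounded_bilinear.bounded_linear_right[OF bounded_bilinear_mcomm]
        rot_has_vector_derivative[OF K]]])
  \<comment> \<open>The second derivative of \<open>f\<close> at 0 is twice the product of TT* - T*T
    with \<open>Q\<close>, which is 2 |T|^2 because QT = T and QT* = 0.\<close>
  moreover have "mcomm K (mcomm K R) = 2 *\<^sub>R (T ** T' - T' ** T)"
    unfolding K_def mcomm_def matrix_distribs matrix_mul_assoc
    by (simp add: T T' matrix_distribs scaleR_2 flip: matrix_mul_assoc)
  then have "mcomm K (mcomm K (rot (0 *\<^sub>R K) R)) \<bullet> Q = 2 * (T \<bullet> T)"
    using inner_matrix_mult_right[of T T' Q] inner_matrix_mult_right[of T' T Q] T T'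
    by (simp add: inner_diff_left T'_def inner_matrix_mult_left)
  moreover have "T \<bullet> T > 0"
    using W by (simp add: T_def)
  ultimately obtain d where d: "d > 0" "\<And>h. h > 0 \<Longrightarrow> h < d \<Longrightarrow> f1 0 < f1 h"
    using DERIV_pos_inc_right[of f1 _ 0] by force
  have "f1 0 = 0"
    using comm by (simp add: f1_def inner_mcomm) (simp add: mcomm_def)
  obtain z where "z > 0" "z < d / 2" "f (d / 2) - f 0 = (d / 2 - 0) * f1 z"
    using MVT2[of 0 "d / 2" f f1] f d(1) by auto
  then have "f 0 < f (d / 2)"
    using d(2)[of z] d(1) \<open>f1 0 = 0\<close> by (smt (verit) field_sum_of_halves mult_pos_pos)
  with that[OF skew_scaleR[OF K, of "d / 2"]] show thesis
    by (simp add: f_def)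
qed

text \<open>If \<open>R\<close> and \<open>Q\<close> do not commute, the first derivative already
  gives the increase by \<open>critical_point_commutes\<close>; otherwise the second derivative
  does.\<close>

lemma improvement:
  fixes R Q :: "'f::real_or_complex^'n^'n"
  assumes R: "R \<in> Gr k" and Q: "Q \<in> Gr k" and neq: "R \<noteq> Q"
  obtains K where "skew K" "R \<bullet> Q < rot K R \<bullet> Q"
proof (cases "mcomm Q R = 0")
  case True
  then show thesis
    using commuting_improvement[of R Q] that assms by (metis Gr_iff mcomm_def right_minus_eq)
next
  case False
  then show thesis
    using critical_point_commutes[of R Q] that R Q by (metis Gr_iff herm_projD(4) not_le)
qed

text \<open>Newton iteration from \<open>P\<close> converges to \<open>Q\<close>. Each step at least
  halves the error, so the accumulated generators stay bounded and \<open>rot_compactness\<close>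
  produces a single rotation.\<close>

lemma rot_reaches_near:
  obtains e where "e > 0" and "\<And>k P Q :: 'f::real_or_complex^'n^'n. P \<in> Gr k \<Longrightarrow> Q \<in> Gr k \<Longrightarrow>
    norm (P - Q) \<le> e \<Longrightarrow> \<exists>K. skew K \<and> rot K P = Q"
proof -
  obtain C where C: "C \<ge> 0" "\<And>P Q. herm_proj P \<Longrightarrow> herm_proj Q \<Longrightarrow>
       norm (rot (mcomm Q P) P - (Q :: 'f^'n^'n)) \<le> C * (norm (Q - P))\<^sup>2"
    using rot_newton by blast
  show ?thesis
  \<comment> \<open>This radius makes C D at most 1/2, which turns the quadratic Newton estimate
    into halving.\<close>
  proof (rule that[of "1 / (2 * C + 1)"])
    fix k and P Q :: "'f^'n^'n"
    assume P: "P \<in> Gr k" and Q: "Q \<in> Gr k" and near: "norm (P - Q) \<le> 1 / (2 * C + 1)"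
    define D where "D = norm (P - Q)"
    have CD: "C * D \<le> 1 / 2"
    proof -
      have "C * D \<le> C * (1 / (2 * C + 1))"
        using C(1) near by (intro mult_left_mono) (simp_all add: D_def)
      also have "\<dots> \<le> 1 / 2" using C(1) by (simp add: field_simps)
      finally show ?thesis .
    qed
    define X where "X = rec_nat P (\<lambda>_ Y. rot (mcomm Q Y) Y)"
    have X: "X 0 = P" "X (Suc j) = rot (mcomm Q (X j)) (X j)" for j
      by (simp_all add: X_def)
    \<comment> \<open>The bound 2 D - 2 D / 2^j is the geometric sum of the first \<open>j\<close>
      error bounds, each of which bounds one Newton generator.\<close>
    have inv: "X j \<in> Gr k \<and> norm (X j - Q) \<le> D / 2 ^ j \<and>
        (\<exists>K. skew K \<and> norm K \<le> 2 * D - 2 * (D / 2 ^ j) \<and> rot K P = X j)" for j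
    proof (induction j)
      case 0
      show ?case using P by (auto simp: X D_def intro!: exI[of _ 0])
    next
      case (Suc j)
      then obtain K where K: "skew K" "norm K \<le> 2 * D - 2 * (D / 2 ^ j)" "rot K P = X j"
        and Xj: "X j \<in> Gr k" "norm (X j - Q) \<le> D / 2 ^ j" by auto
      have proj: "herm_proj (X j)" "herm_proj Q" using Xj Q by (auto simp: Gr_iff)
      have sk: "skew (mcomm Q (X j))" using proj by (simp add: skew_mcomm herm_projD)
      have "norm (X (Suc j) - Q) \<le> C * (norm (X j - Q))\<^sup>2"
        using C(2)[OF proj] by (simp add: X norm_minus_commute)
      also have "\<dots> \<le> C * (D * (D / 2 ^ j))"
      proof -
        have "D / 2 ^ j \<le> D"
          by (simp add: D_def field_simps mult_le_cancel_left1)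
        then show ?thesis
          unfolding power2_eq_square using Xj C(1) by (intro mult_left_mono mult_mono) (auto simp: D_def)
      qed
      also have "\<dots> \<le> (1 / 2) * (D / 2 ^ j)"
        using CD mult_right_mono[of "C * D" "1/2" "D / 2 ^ j"] by (simp add: D_def mult.assoc)
      finally have 1: "norm (X (Suc j) - Q) \<le> D / 2 ^ Suc j" by simp
      obtain J where J: "skew J" "norm J \<le> norm K + norm (mcomm Q (X j))" "rot J P = X (Suc j)"
        using rot_comp[OF P K(1) sk] K(3) X(2) by metis
      have "norm (mcomm Q (X j)) \<le> D / 2 ^ j"
        using norm_mcomm_le[OF proj(1), of "Q - X j"] Xj(2) by (simp add: mcomm_simps norm_minus_commute)
      then have "norm J \<le> 2 * D - 2 * (D / 2 ^ Suc j)"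
        using J(2) K(2) by simp
      then show ?case
        using 1 J rot_in_Gr[OF J(1) P] by auto
    qed
    then obtain K where K: "\<And>j. skew (K j)" "\<And>j. norm (K j) \<le> 2 * D - 2 * (D / 2 ^ j)" "\<And>j. rot (K j) P = X j"
      by metis
    have "norm (K j) \<le> 2 * D" for j
      using K(2)[of j] by (smt (verit) D_def divide_nonneg_pos norm_ge_zero zero_less_power)
    then have "bounded (range K)" by (auto simp: bounded_iff)
    moreover have "(\<lambda>j. D * (1 / 2) ^ j) \<longlonglongrightarrow> D * 0"
      by (intro tendsto_mult tendsto_const LIMSEQ_power_zero) simp
    then have "(\<lambda>j. X j - Q) \<longlonglongrightarrow> 0"
      by (intro Lim_null_comparison[of "\<lambda>j. X j - Q"] always_eventually allI)
        (use inv in \<open>simp_all add: power_one_over\<close>)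
    then have "(\<lambda>j. rot (K j) P) \<longlonglongrightarrow> Q"
      unfolding K(3) by (rule LIM_zero_cancel)
    ultimately show "\<exists>K. skew K \<and> rot K P = Q"
      using rot_compactness[of P K Q] K(1) P by (metis Gr_iff)
  qed (use C in simp)
qed

text \<open>The product with \<open>Q\<close> is maximized over the closure of the orbit of
  \<open>P\<close>. The maximizer can only be \<open>Q\<close>, so the orbit comes close to
  \<open>Q\<close>, and \<open>rot_reaches_near\<close> bridges the remaining gap.\<close>

lemma Gr_connected:
  fixes P Q :: "'f::real_or_complex^'n^'n"
  assumes P: "P \<in> Gr k" and Q: "Q \<in> Gr k"
  obtains K where "skew K" "rot K P = Q"
proof -
  define S where "S = {rot K P | K. skew K}"
  have trans: "rot L X \<in> S" if "X \<in> S" "skew L" for X L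
  proof -
    from that(1) obtain K where "skew K" "X = rot K P" by (auto simp: S_def)
    then show ?thesis
      using rot_comp[OF P _ that(2)] unfolding S_def by (metis (mono_tags, lifting) mem_Collect_eq)
  qed
  have "S \<subseteq> Gr k" using rot_in_Gr P by (auto simp: S_def)
  then have clS: "closure S \<subseteq> Gr k"
    by (intro closure_minimal compact_imp_closed compact_Gr)
  then have "compact (closure S)"
    by (metis closed_closure compact_Gr compact_Int_closed inf.absorb2)
  moreover have "P \<in> S" using skew_0 rot_0 unfolding S_def by (metis (mono_tags, lifting) mem_Collect_eq)
  then have "closure S \<noteq> {}" by auto
  moreover have "continuous_on (closure S) (\<lambda>X. X \<bullet> Q)"
    by (intro continuous_intros)
  ultimately obtain R where R: "R \<in> closure S" and max: "\<And>X. X \<in> closure S \<Longrightarrow> X \<bullet> Q \<le> R \<bullet> Q"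
    using continuous_attains_sup[of "closure S" "\<lambda>X. X \<bullet> Q"] by blast
  \<comment> \<open>An improving rotation of \<open>R\<close> stays in the closure, since
    \<open>rot K\<close> is an isometry that maps the orbit into itself.\<close>
  have "R = Q"
  proof (rule ccontr)
    assume "R \<noteq> Q"
    then obtain K where K: "skew K" "R \<bullet> Q < rot K R \<bullet> Q"
      using improvement[of R k Q] R clS Q by blast
    obtain X where X: "\<And>n. X n \<in> S" "X \<longlonglongrightarrow> R"
      using R closure_sequential by blast
    have "(\<lambda>n. rot K (X n) - rot K R) \<longlonglongrightarrow> 0"
      using X(2) by (intro tendsto_norm_zero_cancel[of "\<lambda>n. rot K (X n) - rot K R"])
        (simp add: rot_isometric[OF K(1)] LIM_zero tendsto_norm_zero)
    then have "(\<lambda>n. rot K (X n)) \<longlonglongrightarrow> rot K R"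
      by (rule LIM_zero_cancel)
    then have "rot K R \<in> closure S"
      unfolding closure_sequential using trans[OF X(1) K(1)] by (intro exI[of _ "\<lambda>n. rot K (X n)"]) simp
    with max K(2) show False by fastforce
  qed
  obtain e where e: "e > 0" "\<And>k P Q :: 'f^'n^'n. P \<in> Gr k \<Longrightarrow> Q \<in> Gr k \<Longrightarrow>
    norm (P - Q) \<le> e \<Longrightarrow> \<exists>K. skew K \<and> rot K P = Q"
    using rot_reaches_near by blast
  obtain X where X: "X \<in> S" "dist X Q < e"
    using R \<open>R = Q\<close> e(1) closure_approachable by blast
  then obtain L where "skew L" "rot L X = Q"
    using e(2)[of X k Q] Q \<open>S \<subseteq> Gr k\<close> by (auto simp: dist_norm)
  then have "Q \<in> S" using trans X(1) by blast
  then show thesis using that by (auto simp: S_def)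
qed

section \<open>Riemannian distance and logarithm on the Grassmannian\<close>

lemma curve_length_nonneg: "admissible_path M P Q c \<Longrightarrow> 0 \<le> curve_length c"
  unfolding admissible_path_def curve_length_def by (intro integral_nonneg) auto

lemma rdist_le_curve_length:
  assumes "admissible_path M P Q c"
  shows "rdist M P Q \<le> curve_length c"
  unfolding rdist_def using assms curve_length_nonneg
  by (intro cInf_lower bdd_belowI[of _ 0]) auto

text \<open>The path is cut at equal arc length, and a chord is at most as long as its arc.\<close>

lemma admissible_path_equipartition:
  assumes c: "admissible_path M P Q c" and N: "N > 0"
  obtains p where "\<And>i. p i \<in> M" "p 0 = P" "p N = Q"
    "\<And>i. i < N \<Longrightarrow> norm (p (Suc i) - p i) \<le> curve_length c / N"
proof -
  define f where "f = (\<lambda>t. norm (vector_derivative c (at t)))"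
  define s where "s x = integral {0..x} f" for x
  have int: "f integrable_on {0..1}" and cont: "continuous_on {0..1} c"
    and img: "c ` {0..1} \<subseteq> M" and ends: "c 0 = P" "c 1 = Q"
    using c unfolding admissible_path_def f_def piecewise_C1_differentiable_on_def path_image_def
      pathstart_def pathfinish_def by auto
  obtain S where S: "finite S" "c C1_differentiable_on ({0..1} - S)"
    using c unfolding admissible_path_def piecewise_C1_differentiable_on_def by blast
  have chord: "norm (c b - c a) \<le> s b - s a" if ab: "0 \<le> a" "a \<le> b" "b \<le> 1" for a b
  proof -
    have "((\<lambda>t. vector_derivative c (at t)) has_integral (c b - c a)) {a..b}"
    proof (rule fundamental_theorem_of_calculus_interior_strong[OF S(1) ab(2)])
      show "(c has_vector_derivative vector_derivative c (at x)) (at x)" if "x \<in> {a<..<b} - S" for x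
        using S(2) ab that unfolding C1_differentiable_on_eq by (auto simp: vector_derivative_works)
      show "continuous_on {a..b} c"
        using cont ab by (auto intro: continuous_on_subset)
    qed
    moreover have "f integrable_on {a..b}"
      using int ab by (auto intro: integrable_subinterval_real)
    ultimately have "norm (c b - c a) \<le> integral {a..b} f"
      using integral_norm_bound_integral[of "\<lambda>t. vector_derivative c (at t)" "{a..b}" f]
      by (simp add: f_def has_integral_iff)
    also have "\<dots> = s b - s a"
      using Henstock_Kurzweil_Integration.integral_combine[of 0 a b f] ab int
        integrable_subinterval_real[OF int, of 0 b]
      by (simp add: s_def)
    finally show ?thesis .
  qed
  have chord': "norm (c b - c a) \<le> \<bar>s b - s a\<bar>" if "a \<in> {0..1}" "b \<in> {0..1}" for a b
    using that chord[of a b] chord[of b a] norm_minus_commute[of "c a" "c b"] by (cases "a \<le> b") auto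
  have s01: "s 0 = 0" "s 1 = curve_length c"
    by (simp_all add: s_def curve_length_def f_def)
  have conts: "continuous_on {0..1} s"
    unfolding s_def by (rule indefinite_integral_continuous_1[OF int])
  \<comment> \<open>Arc length need not be strictly increasing, so the parameters at the two ends
    are prescribed explicitly.\<close>
  have "\<exists>t. t \<in> {0..1} \<and> s t = real i * (curve_length c / N) \<and> (i = 0 \<longrightarrow> t = 0) \<and> (i = N \<longrightarrow> t = 1)"
    if "i \<le> N" for i
  proof -
    consider "i = 0" | "i = N" | "0 < i" "i < N" using \<open>i \<le> N\<close> by linarith
    then show ?thesis
    proof cases
      case 3
      have "real i * (curve_length c / N) \<le> curve_length c"
        using 3 curve_length_nonneg[OF c] by (simp add: field_simps mult_left_mono)
      then show ?thesis
        using IVT'[of s 0 "real i * (curve_length c / N)" 1] s01 conts curve_length_nonneg[OF c] 3 by auto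
    qed (use s01 N in \<open>auto intro: exI[of _ 0] exI[of _ 1]\<close>)
  qed
  then obtain t where t: "\<And>i. i \<le> N \<Longrightarrow> t i \<in> {0..1::real}"
    "\<And>i. i \<le> N \<Longrightarrow> s (t i) = real i * (curve_length c / N)"
    "t 0 = 0" "t N = 1"
    by (metis le0 order_refl)
  show thesis
  proof
    \<comment> \<open>Capping the index at \<open>N\<close> extends the chain by its last
      point.\<close>
    show "c (t (min i N)) \<in> M" for i
      using t(1)[of "min i N"] img by auto
    show "norm (c (t (min (Suc i) N)) - c (t (min i N))) \<le> curve_length c / N" if "i < N" for i
      using chord'[of "t i" "t (Suc i)"] t(1,2)[of i] t(1,2)[of "Suc i"] that curve_length_nonneg[OF c]
      by (simp add: add_divide_distrib distrib_right)
  qed (use t ends in simp_all)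
qed

lemma admissible_path_rot:
  fixes P :: "'f::real_or_complex^'n^'n"
  assumes P: "P \<in> Gr k" and K: "skew K"
  shows "admissible_path (Gr k) P (rot K P) (\<lambda>t. rot (t *\<^sub>R K) P)"
    and "curve_length (\<lambda>t. rot (t *\<^sub>R K) P) \<le> norm K"
proof -
  let ?c = "\<lambda>t. rot (t *\<^sub>R K) P"
  have d: "(?c has_vector_derivative mcomm K (?c t)) (at t)" for t
    by (rule rot_has_vector_derivative[OF K])
  have vd: "vector_derivative ?c (at t) = mcomm K (?c t)" for t
    by (rule vector_derivative_at[OF d])
  have c: "?c t \<in> Gr k" for t
    by (rule rot_in_Gr[OF skew_scaleR[OF K] P])
  have "continuous_on {0..1} ?c"
    by (intro continuous_at_imp_continuous_on ballI has_vector_derivative_continuous[OF d])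
  then have cont: "continuous_on {0..1} (\<lambda>t. mcomm K (?c t))"
    by (intro bounded_bilinear.continuous_on[OF bounded_bilinear_mcomm] continuous_on_const)
  then have "?c C1_differentiable_on {0..1}"
    unfolding C1_differentiable_on_def using d by (intro exI[of _ "\<lambda>t. mcomm K (?c t)"]) simp
  moreover have int: "(\<lambda>t. norm (vector_derivative ?c (at t))) integrable_on {0..1}"
    unfolding vd by (intro integrable_continuous_real continuous_on_norm cont)
  ultimately show "admissible_path (Gr k) P (rot K P) ?c"
    using c by (auto simp: admissible_path_def path_image_def pathstart_def pathfinish_def
        intro!: C1_differentiable_imp_piecewise)
  have "curve_length ?c \<le> integral {0..1} (\<lambda>t::real. norm K)"
    unfolding curve_length_def
  proof (rule integral_le[OF int])
    show "norm (vector_derivative ?c (at t)) \<le> norm K" for t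
      unfolding vd using c[of t] by (intro norm_mcomm_le) (simp add: Gr_iff)
  qed (rule integrable_const_ivl)
  then show "curve_length ?c \<le> norm K" by simp
qed

lemma rdist_rot_le:
  assumes "P \<in> Gr k" "skew K"
  shows "rdist (Gr k) P (rot K P) \<le> norm K"
  using rdist_le_curve_length[OF admissible_path_rot(1)[OF assms]] admissible_path_rot(2)[OF assms]
  by (rule order_trans)

text \<open>Connectedness makes the set of lengths nonempty, so its infimum is meaningful. Paths
  within 1/(N + 1) of it, cut into \<open>N\<close> steps, feed \<open>rot_of_chains\<close>; the
  limit generator has norm at most the distance, and \<open>rdist_rot_le\<close> gives
  equality.\<close>

lemma rdist_attained:
  fixes P Q :: "'f::real_or_complex^'n^'n"
  assumes P: "P \<in> Gr k" and Q: "Q \<in> Gr k"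
  obtains K where "skew K" "mcomm (mcomm K P) P = K" "norm K = rdist (Gr k) P Q" "rot K P = Q"
proof -
  define d where "d = rdist (Gr k) P Q"
  let ?L = "{curve_length c | c. admissible_path (Gr k) P Q c}"
  obtain K0 where "skew K0" "rot K0 P = Q"
    using Gr_connected[OF P Q] by blast
  then have "?L \<noteq> {}"
    using admissible_path_rot(1)[OF P \<open>skew K0\<close>] by auto
  have lim: "(\<lambda>N. d + inverse (real (Suc N))) \<longlonglongrightarrow> d"
    using tendsto_add[OF tendsto_const[of d] LIMSEQ_inverse_real_of_nat] by simp
  obtain K where K: "skew K" "mcomm (mcomm K P) P = K" "norm K \<le> d" "rot K P = Q"
  proof (rule rot_of_chains[OF P lim, of Q])
    fix N :: nat assume N: "N > 0"
    have "Inf ?L < d + inverse (real (Suc N))"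
      by (simp add: d_def rdist_def)
    then obtain c where c: "admissible_path (Gr k) P Q c" "curve_length c < d + inverse (real (Suc N))"
      using cInf_lessD[OF \<open>?L \<noteq> {}\<close>] by blast
    obtain p where p: "\<And>i. p i \<in> Gr k" "p 0 = P" "p N = Q"
      "\<And>i. i < N \<Longrightarrow> norm (p (Suc i) - p i) \<le> curve_length c / N"
      using admissible_path_equipartition[OF c(1) N] by blast
    moreover have "curve_length c / N \<le> (d + inverse (real (Suc N))) / N"
      using c(2) by (intro divide_right_mono) auto
    ultimately show "\<exists>p. (\<forall>i. p i \<in> Gr k) \<and> p 0 = P \<and> p N = Q \<and>
        (\<forall>i<N. norm (p (Suc i) - p i) \<le> (d + inverse (real (Suc N))) / N)"
      by (intro exI[of _ p]) force
  qed (use that in blast)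
  have "norm K = rdist (Gr k) P Q"
    using K(3) rdist_rot_le[OF P K(1)] by (simp add: d_def K(4))
  with K that show thesis by blast
qed

lemma rdist_nonneg:
  assumes "P \<in> Gr k" "Q \<in> Gr k"
  shows "0 \<le> rdist (Gr k) P Q"
proof -
  obtain K where K: "norm K = rdist (Gr k) P Q" "rot K P = Q"
    using rdist_attained[OF assms] by blast
  then show ?thesis using norm_ge_zero[of K] by simp
qed

lemma rdist_pos:
  assumes "P \<in> Gr k" "Q \<in> Gr k" "P \<noteq> Q"
  shows "0 < rdist (Gr k) P Q"
proof -
  obtain K where K: "norm K = rdist (Gr k) P Q" "rot K P = Q"
    using rdist_attained[OF assms(1,2)] by blast
  then have "K \<noteq> 0" using assms(3) by auto
  then show ?thesis using K(1) zero_less_norm_iff[of K] by simp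
qed

lemma rdist_sym:
  fixes P Q :: "'f::real_or_complex^'n^'n"
  assumes "P \<in> Gr k" "Q \<in> Gr k"
  shows "rdist (Gr k) P Q = rdist (Gr k) Q P"
proof -
  have "rdist (Gr k) Q P \<le> rdist (Gr k) P Q" if PQ: "P \<in> Gr k" "Q \<in> Gr k" for P Q :: "'f^'n^'n"
  proof -
    obtain K where K: "skew K" "norm K = rdist (Gr k) P Q" "rot K P = Q"
      using rdist_attained[OF PQ] by metis
    then show ?thesis
      using rdist_rot_le[OF PQ(2) skew_minus[OF K(1)]] rot_minus_cancel[OF K(1), of P] by simp
  qed
  with assms show ?thesis by (simp add: antisym)
qed

lemma rdist_hinge:
  assumes "P \<in> Gr k" "skew K" "skew L"
  shows "rdist (Gr k) (rot K P) (rot L P) \<le> norm (K - L)"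
proof -
  obtain J where J: "skew J" "norm J \<le> norm (K - L)" "rot J (rot K P) = rot L P"
    using rot_hinge[OF assms] by blast
  then show ?thesis
    using rdist_rot_le[OF rot_in_Gr[OF assms(2,1)] J(1)] by simp
qed

lemma rdist_triangle:
  assumes P: "P \<in> Gr k" and Q: "Q \<in> Gr k" and R: "R \<in> Gr k"
  shows "rdist (Gr k) P R \<le> rdist (Gr k) P Q + rdist (Gr k) Q R"
proof -
  obtain K where K: "skew K" "norm K = rdist (Gr k) P Q" "rot K P = Q"
    using rdist_attained[OF P Q] by metis
  obtain L where L: "skew L" "norm L = rdist (Gr k) Q R" "rot L Q = R"
    using rdist_attained[OF Q R] by metis
  obtain J where J: "skew J" "norm J \<le> norm K + norm L" "rot J P = rot L (rot K P)"
    using rot_comp[OF P K(1) L(1)] by blast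
  then show ?thesis
    using rdist_rot_le[OF P J(1)] K L by simp
qed

text \<open>The minimizing generator \<open>K\<close> corresponds to v = [K, P]. As commutation with
  \<open>P\<close> is a contraction that also sends \<open>v\<close> back to \<open>K\<close>, the
  norms agree. Injectivity of \<open>Exp\<close> makes \<open>v\<close> the only candidate.\<close>

lemma rlog_Gr:
  fixes P Q :: "'f::real_or_complex^'n^'n"
  assumes P: "P \<in> Gr k" and Q: "Q \<in> Gr k"
    and near: "ereal (rdist (Gr k) P Q) < injectivity_radius (Gr k :: ('f^'n^'n) set)"
  shows "rlog (Gr k) P Q \<in> tangent_space (Gr k) P" "norm (rlog (Gr k) P Q) = rdist (Gr k) P Q"
    "rot (mcomm (rlog (Gr k) P Q) P) P = Q"
proof -
  have proj: "herm_proj P" using P by (simp add: Gr_iff)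
  obtain K where K: "skew K" "mcomm (mcomm K P) P = K" "norm K = rdist (Gr k) P Q" "rot K P = Q"
    using rdist_attained[OF P Q] by metis
  define v where "v = mcomm K P"
  have v: "v \<in> tangent_space (Gr k) P"
    using K(1) mcomm_cube[OF proj]
    by (simp add: tangent_space_Gr[OF P] v_def conj_transpose_mcomm herm_projD[OF proj] skew_def mcomm_simps)
      (simp add: mcomm_anticommute[of P K])
  have normv: "norm v = rdist (Gr k) P Q"
    using norm_mcomm_le[OF proj, of K] norm_mcomm_le[OF proj, of v] K(2,3) by (simp add: v_def)
  have vQ: "rot (mcomm v P) P = Q"
    using K by (simp add: v_def)
  have "rlog (Gr k) P Q = v"
    unfolding rlog_def
  proof (rule the_equality)
    show "v \<in> tangent_space (Gr k) P \<and> ereal (norm v) < injectivity_radius (Gr k :: ('f^'n^'n) set) \<and> Exp (Gr k) P v = Q"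
      using v near vQ by (simp add: normv Exp_Gr[OF P v])
  next
    fix w assume w: "w \<in> tangent_space (Gr k) P \<and> ereal (norm w) < injectivity_radius (Gr k :: ('f^'n^'n) set) \<and> Exp (Gr k) P w = Q"
    \<comment> \<open>Both candidates are shorter than the injectivity radius at \<open>P\<close>,
      so one radius \<open>R\<close> gives a ball that contains both and on which \<open>Exp\<close>
      is injective.\<close>
    have "injectivity_radius (Gr k :: ('f^'n^'n) set) \<le> injectivity_radius_at (Gr k) P"
      unfolding injectivity_radius_def by (rule INF_lower[OF P])
    then have "max (ereal (norm v)) (ereal (norm w)) < injectivity_radius_at (Gr k) P"
      using w near by (auto simp: normv intro: less_le_trans)
    then obtain R where R: "max (ereal (norm v)) (ereal (norm w)) < ereal R"
      and "diffeo_onto_image {v \<in> tangent_space (Gr k) P. norm v < R} (Exp (Gr k) P)"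
      unfolding injectivity_radius_at_def less_Sup_iff by blast
    then have inj: "inj_on (Exp (Gr k) P) {v \<in> tangent_space (Gr k) P. norm v < R}"
      by (simp add: diffeo_onto_image_def)
    show "w = v"
      by (rule inj_onD[OF inj]) (use w v R vQ in \<open>auto simp: Exp_Gr[OF P v]\<close>)
  qed
  then show "rlog (Gr k) P Q \<in> tangent_space (Gr k) P" "norm (rlog (Gr k) P Q) = rdist (Gr k) P Q"
    "rot (mcomm (rlog (Gr k) P Q) P) P = Q"
    using v normv vQ by auto
qed

section \<open>Comparison with Euclidean triangles\<close>

text \<open>With a zero vector both sides vanish, whatever the angle.\<close>

lemma norm_mult_cos_vec_angle: "norm u * norm v * cos (vec_angle u v) = u \<bullet> v"
proof (cases "u = 0 \<or> v = 0")
  case False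
  then have "\<bar>(u \<bullet> v) / (norm u * norm v)\<bar> \<le> 1"
    using Cauchy_Schwarz_ineq2[of u v] by (simp add: abs_mult)
  then show ?thesis
    using False by (simp add: vec_angle_def cos_arccos_abs)
qed auto

lemma vec_angle_bounds: "0 \<le> vec_angle u v" "vec_angle u v \<le> pi"
proof -
  define q where "q = (u \<bullet> v) / (norm u * norm v)"
  have "\<bar>q\<bar> \<le> 1"
    using Cauchy_Schwarz_ineq2[of u v] by (cases "u = 0 \<or> v = 0") (auto simp: abs_mult q_def)
  then show "0 \<le> vec_angle u v" "vec_angle u v \<le> pi"
    by (simp_all add: vec_angle_def abs_le_iff arccos_lbound arccos_ubound flip: q_def)
qed

text \<open>The Euclidean law of cosines in the tangent space at \<open>P\<close>, combined with
  \<open>rdist_hinge\<close> and the contraction property of commutation with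
  \<open>P\<close>.\<close>

lemma law_of_cosines_Gr:
  fixes P Q R :: "'f::real_or_complex^'n^'n"
  assumes P: "P \<in> Gr k" and Q: "Q \<in> Gr k" and R: "R \<in> Gr k"
    and near: "ereal (rdist (Gr k) P Q) < injectivity_radius (Gr k :: ('f^'n^'n) set)"
      "ereal (rdist (Gr k) P R) < injectivity_radius (Gr k :: ('f^'n^'n) set)"
  shows "(rdist (Gr k) Q R)\<^sup>2 \<le> (rdist (Gr k) P Q)\<^sup>2 + (rdist (Gr k) P R)\<^sup>2
    - 2 * rdist (Gr k) P Q * rdist (Gr k) P R * cos (angle_at (Gr k) P Q R)"
proof -
  note u = rlog_Gr[OF P Q near(1)] and v = rlog_Gr[OF P R near(2)]
  let ?u = "rlog (Gr k) P Q" and ?v = "rlog (Gr k) P R"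
  have "rdist (Gr k) Q R \<le> norm (mcomm ?u P - mcomm ?v P)"
    using rdist_hinge[OF P skew_tangent[OF P u(1)] skew_tangent[OF P v(1)]] u(3) v(3) by simp
  also have "\<dots> \<le> norm (?u - ?v)"
    using P norm_mcomm_le[of P "?u - ?v"] by (simp add: Gr_iff mcomm_simps)
  finally have "(rdist (Gr k) Q R)\<^sup>2 \<le> (norm (?u - ?v))\<^sup>2"
    using rdist_nonneg[OF Q R] by (rule power_mono)
  also have "\<dots> = (norm ?u)\<^sup>2 + (norm ?v)\<^sup>2 - 2 * (?u \<bullet> ?v)"
    by (simp add: power2_norm_eq_inner inner_diff_left inner_diff_right inner_commute)
  also have "?u \<bullet> ?v = norm ?u * norm ?v * cos (angle_at (Gr k) P Q R)"
    by (simp add: angle_at_def norm_mult_cos_vec_angle)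
  finally show ?thesis
    by (simp add: u(2) v(2) mult.assoc)
qed

text \<open>Seen from the midpoint, \<open>A\<close>, \<open>B\<close>, \<open>C\<close> are reached
  by the generators - H, H, L, and \<open>rdist_hinge\<close> compares their distances with the
  Euclidean parallelogram identity. \<open>L\<close> comes from \<open>rdist_attained\<close>, so
  \<open>M\<close> and \<open>C\<close> need not lie within the injectivity radius of each
  other.\<close>

lemma semi_parallelogram_Gr:
  fixes A B C :: "'f::real_or_complex^'n^'n"
  assumes A: "A \<in> Gr k" and B: "B \<in> Gr k" and C: "C \<in> Gr k"
    and near: "ereal (rdist (Gr k) A B) < injectivity_radius (Gr k :: ('f^'n^'n) set)"
  shows "((rdist (Gr k) A C)\<^sup>2 + (rdist (Gr k) B C)\<^sup>2) / 2 - (rdist (Gr k) A B)\<^sup>2 / 4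
    \<le> (rdist (Gr k) (geodesic_midpoint (Gr k) A B) C)\<^sup>2"
proof -
  define v where "v = rlog (Gr k) A B"
  note v = rlog_Gr[OF A B near, folded v_def]
  define H where "H = (1/2) *\<^sub>R mcomm v A"
  have H: "skew H"
    unfolding H_def by (intro skew_scaleR skew_tangent[OF A v(1)])
  define M where "M = geodesic_midpoint (Gr k) A B"
  have "(1/2) *\<^sub>R v \<in> tangent_space (Gr k) A"
    by (intro subspace_scale subspace_tangent_space_Gr A v(1))
  then have M: "M = rot H A"
    using Exp_Gr[OF A] by (simp add: M_def geodesic_midpoint_def geodesic_point_def H_def v_def mcomm_simps)
  have MGr: "M \<in> Gr k"
    unfolding M by (rule rot_in_Gr[OF H A])
  have MA: "rot (- H) M = A"
    unfolding M by (rule rot_minus_cancel[OF H])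
  have MB: "rot H M = B"
    using rot_add[OF skew_tangent[OF A v(1)], of "1/2" "1/2" A] v(3) by (simp add: M H_def)
  obtain L where L: "skew L" "norm L = rdist (Gr k) M C" "rot L M = C"
    using rdist_attained[OF MGr C] by metis
  have AC: "(rdist (Gr k) A C)\<^sup>2 \<le> (norm (- H - L))\<^sup>2"
    using rdist_hinge[OF MGr skew_minus[OF H] L(1)] rdist_nonneg[OF A C]
    by (intro power_mono) (simp_all add: MA L)
  have BC: "(rdist (Gr k) B C)\<^sup>2 \<le> (norm (H - L))\<^sup>2"
    using rdist_hinge[OF MGr H L(1)] rdist_nonneg[OF B C]
    by (intro power_mono) (simp_all add: MB L)
  have sum: "(norm (- H - L))\<^sup>2 + (norm (H - L))\<^sup>2 = 2 * (norm H)\<^sup>2 + 2 * (norm L)\<^sup>2"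
    by (simp add: power2_norm_eq_inner inner_diff_left inner_diff_right inner_commute)
  have "norm H \<le> norm v / 2"
    using norm_mcomm_le[of A v] A by (simp add: H_def Gr_iff)
  then have "(norm H)\<^sup>2 \<le> (norm v / 2)\<^sup>2"
    by (intro power_mono) auto
  then have AB: "(norm H)\<^sup>2 \<le> (rdist (Gr k) A B)\<^sup>2 / 4"
    by (simp add: v(2) power_divide)
  have "(rdist (Gr k) A C)\<^sup>2 + (rdist (Gr k) B C)\<^sup>2 \<le> 2 * (norm H)\<^sup>2 + 2 * (norm L)\<^sup>2"
    using add_mono[OF AC BC] by (simp only: sum)
  then have "((rdist (Gr k) A C)\<^sup>2 + (rdist (Gr k) B C)\<^sup>2) / 2 \<le> (norm H)\<^sup>2 + (norm L)\<^sup>2"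
    by simp
  with AB have "((rdist (Gr k) A C)\<^sup>2 + (rdist (Gr k) B C)\<^sup>2) / 2 - (rdist (Gr k) A B)\<^sup>2 / 4 \<le> (norm L)\<^sup>2"
    by linarith
  then show ?thesis
    by (simp only: L(2) M_def)
qed

text \<open>The addition formula gives cos(arccos x + arccos y) = - z; \<open>H\<close> is sixteen
  times the squared area by Heron. If the first two angles sum to at most pi, the total is exactly
  pi, and otherwise the bound is immediate.\<close>

lemma euclidean_angle_sum_ge_pi:
  fixes a b c :: real
  assumes pos: "a > 0" "b > 0" "c > 0" and tri: "a \<le> b + c" "b \<le> a + c" "c \<le> a + b"
  shows "pi \<le> arccos ((b\<^sup>2 + c\<^sup>2 - a\<^sup>2) / (2 * b * c)) + arccos ((a\<^sup>2 + c\<^sup>2 - b\<^sup>2) / (2 * a * c))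
    + arccos ((a\<^sup>2 + b\<^sup>2 - c\<^sup>2) / (2 * a * b))" (is ?sum)
  and "\<bar>(b\<^sup>2 + c\<^sup>2 - a\<^sup>2) / (2 * b * c)\<bar> \<le> 1" (is ?bound)
proof -
  define x where "x = (b\<^sup>2 + c\<^sup>2 - a\<^sup>2) / (2 * b * c)"
  define y where "y = (a\<^sup>2 + c\<^sup>2 - b\<^sup>2) / (2 * a * c)"
  define z where "z = (a\<^sup>2 + b\<^sup>2 - c\<^sup>2) / (2 * a * b)"
  define H where "H = (2 * b * c)\<^sup>2 - (b\<^sup>2 + c\<^sup>2 - a\<^sup>2)\<^sup>2"
  have bound: "\<bar>(q\<^sup>2 + r\<^sup>2 - p\<^sup>2) / (2 * q * r)\<bar> \<le> 1"
    if "p > 0" "q > 0" "r > 0" "p \<le> q + r" "q \<le> p + r" "r \<le> p + q" for p q r :: real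
  proof -
    have "(q - r)\<^sup>2 \<le> p\<^sup>2" "p\<^sup>2 \<le> (q + r)\<^sup>2"
      using that by (intro power2_le_iff_abs_le[THEN iffD2] power_mono; simp)+
    then have "\<bar>q\<^sup>2 + r\<^sup>2 - p\<^sup>2\<bar> \<le> 2 * q * r"
      by (simp add: power2_diff power2_sum abs_le_iff)
    then show ?thesis
      using that by (simp add: abs_mult)
  qed
  have x: "\<bar>x\<bar> \<le> 1" and y: "\<bar>y\<bar> \<le> 1" and z: "\<bar>z\<bar> \<le> 1"
    unfolding x_def y_def z_def using pos tri by (intro bound; simp add: add.commute)+
  from x show ?bound by (simp add: x_def)
  have x2: "1 - x\<^sup>2 = H / (2 * b * c)\<^sup>2" and y2: "1 - y\<^sup>2 = H / (2 * a * c)\<^sup>2"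
    using pos by (simp_all add: x_def y_def H_def field_simps power2_eq_square)
  have "0 \<le> 1 - x\<^sup>2"
    using x by (simp add: abs_square_le_1)
  then have H: "H \<ge> 0"
    using pos by (simp add: x2 zero_le_divide_iff)
  have "sin (arccos x) * sin (arccos y) = H / (2 * b * c * (2 * a * c))"
    using x y H pos
    by (simp add: sin_arccos_abs x2 y2 real_sqrt_divide)
  then have "cos (arccos x + arccos y) = x * y - H / (2 * b * c * (2 * a * c))"
    using x y by (simp add: cos_add cos_arccos_abs)
  also have "\<dots> = - z"
    using pos by (simp add: x_def y_def z_def H_def field_simps) (simp add: power2_eq_square power4_eq_xxxx algebra_simps)
  finally have cos: "cos (arccos x + arccos y) = - z" .
  have nonneg: "0 \<le> arccos x" "0 \<le> arccos y" "0 \<le> arccos z"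
    using x y z by (auto simp: abs_le_iff intro!: arccos_lbound)
  show ?sum
  proof (cases "arccos x + arccos y \<le> pi")
    case True
    then have "arccos x + arccos y = arccos (- z)"
      using arccos_cos[of "arccos x + arccos y"] nonneg by (simp add: cos)
    also have "\<dots> = pi - arccos z"
      using z by (intro arccos_minus) auto
    finally show ?sum by (simp add: x_def y_def z_def)
  next
    case False
    with nonneg(3) show ?sum by (simp add: x_def y_def z_def)
  qed
qed

lemma arccos_le_angle:
  fixes a b c \<alpha> :: real
  assumes pos: "b > 0" "c > 0" and \<alpha>: "0 \<le> \<alpha>" "\<alpha> \<le> pi" and "\<bar>(b\<^sup>2 + c\<^sup>2 - a\<^sup>2) / (2 * b * c)\<bar> \<le> 1"
    and "a\<^sup>2 \<le> b\<^sup>2 + c\<^sup>2 - 2 * b * c * cos \<alpha>"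
  shows "arccos ((b\<^sup>2 + c\<^sup>2 - a\<^sup>2) / (2 * b * c)) \<le> \<alpha>"
proof -
  have "cos \<alpha> \<le> (b\<^sup>2 + c\<^sup>2 - a\<^sup>2) / (2 * b * c)"
    using assms by (simp add: field_simps)
  then have "arccos ((b\<^sup>2 + c\<^sup>2 - a\<^sup>2) / (2 * b * c)) \<le> arccos (cos \<alpha>)"
    using assms(5) by (intro arccos_le_arccos; linarith?) simp
  with \<alpha> show ?thesis by (simp add: arccos_cos)
qed

text \<open>Each angle is at least the corresponding angle of the Euclidean triangle with the same
  sides, since arccos is decreasing.\<close>

lemma angle_sum_ge_pi:
  fixes a b c \<alpha> \<beta> \<gamma> :: real
  assumes pos: "a > 0" "b > 0" "c > 0" and tri: "a \<le> b + c" "b \<le> a + c" "c \<le> a + b"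
    and "0 \<le> \<alpha>" "\<alpha> \<le> pi" "0 \<le> \<beta>" "\<beta> \<le> pi" "0 \<le> \<gamma>" "\<gamma> \<le> pi"
    and "a\<^sup>2 \<le> b\<^sup>2 + c\<^sup>2 - 2 * b * c * cos \<alpha>" "b\<^sup>2 \<le> a\<^sup>2 + c\<^sup>2 - 2 * a * c * cos \<beta>"
      "c\<^sup>2 \<le> a\<^sup>2 + b\<^sup>2 - 2 * a * b * cos \<gamma>"
  shows "pi \<le> \<alpha> + \<beta> + \<gamma>"
proof -
  have "arccos ((b\<^sup>2 + c\<^sup>2 - a\<^sup>2) / (2 * b * c)) \<le> \<alpha>"
    using assms euclidean_angle_sum_ge_pi(2)[of a b c] by (intro arccos_le_angle) auto
  moreover have "arccos ((a\<^sup>2 + c\<^sup>2 - b\<^sup>2) / (2 * a * c)) \<le> \<beta>"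
    using assms euclidean_angle_sum_ge_pi(2)[of b a c] by (intro arccos_le_angle) auto
  moreover have "arccos ((a\<^sup>2 + b\<^sup>2 - c\<^sup>2) / (2 * a * b)) \<le> \<gamma>"
    using assms euclidean_angle_sum_ge_pi(2)[of c a b] by (intro arccos_le_angle) auto
  ultimately show ?thesis
    using euclidean_angle_sum_ge_pi(1)[OF pos tri] by linarith
qed

theorem theorem2p3:
  fixes A B C M Z :: "'f::real_or_complex^'n^'n" and k :: nat and s \<alpha> \<beta> \<gamma> :: real
  assumes "Z \<in> Gr k" and "ereal s < convexity_bound (Gr k :: ('f^'n^'n) set)"
    and "A \<in> metric_ball (Gr k) Z s" and "B \<in> metric_ball (Gr k) Z s"
    and "C \<in> metric_ball (Gr k) Z s"
    and "M = geodesic_midpoint (Gr k) A B"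
    and "\<alpha> = angle_at (Gr k) A B C" and "\<beta> = angle_at (Gr k) B A C"
    and "\<gamma> = angle_at (Gr k) C A B"
  shows "(rdist (Gr k) M C)\<^sup>2
           \<ge> ((rdist (Gr k) A C)\<^sup>2 + (rdist (Gr k) B C)\<^sup>2) / 2 - (rdist (Gr k) A B)\<^sup>2 / 4
    \<and> (A \<noteq> B \<and> B \<noteq> C \<and> A \<noteq> C \<longrightarrow>
         (rdist (Gr k) B A)\<^sup>2
           \<le> (rdist (Gr k) C A)\<^sup>2 + (rdist (Gr k) C B)\<^sup>2
              - 2 * rdist (Gr k) C A * rdist (Gr k) C B * cos \<gamma>
         \<and> rdist (Gr k) B A \<ge> rdist (Gr k) C A * cos \<alpha> + rdist (Gr k) C B * cos \<beta>
         \<and> \<alpha> + \<beta> + \<gamma> \<ge> pi)"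
proof -
  let ?G = "Gr k :: ('f^'n^'n) set" and ?d = "rdist (Gr k :: ('f^'n^'n) set)"
  \<comment> \<open>Two points of the ball are less than 2 s apart, and \<open>s\<close> is less
    than half the injectivity radius.\<close>
  have near: "ereal (?d X Y) < injectivity_radius ?G"
    if "X \<in> metric_ball ?G Z s" "Y \<in> metric_ball ?G Z s" for X Y
  proof -
    have "?d X Y \<le> ?d X Z + ?d Z Y" "?d X Z = ?d Z X"
      using that assms(1) rdist_triangle rdist_sym by (auto simp: metric_ball_def)
    then have "?d X Y < 2 * s"
      using that by (auto simp: metric_ball_def)
    moreover have "ereal s < injectivity_radius ?G / 2"
      using assms(2) by (simp add: convexity_bound_def)
    then have "ereal (2 * s) < injectivity_radius ?G"
      by (cases "injectivity_radius ?G") auto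
    ultimately show ?thesis
      by (meson ereal_less_le less_ereal.simps(1) less_trans)
  qed
  have G: "A \<in> Gr k" "B \<in> Gr k" "C \<in> Gr k"
    using assms(3-5) by (auto simp: metric_ball_def)
  define a b c where "a = ?d B C" and "b = ?d A C" and "c = ?d A B"
  have sym: "?d C B = a" "?d C A = b" "?d B A = c"
    using rdist_sym G by (auto simp: a_def b_def c_def)
  have cos_\<alpha>: "a\<^sup>2 \<le> b\<^sup>2 + c\<^sup>2 - 2 * b * c * cos \<alpha>"
    using law_of_cosines_Gr[OF G(1,2,3) near near] assms(3-5,7)
    by (simp add: a_def b_def c_def algebra_simps)
  have cos_\<beta>: "b\<^sup>2 \<le> a\<^sup>2 + c\<^sup>2 - 2 * a * c * cos \<beta>"
    using law_of_cosines_Gr[OF G(2,1,3) near near] assms(3-5,8)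
    by (simp add: sym flip: a_def b_def) (simp add: algebra_simps)
  have cos_\<gamma>: "c\<^sup>2 \<le> b\<^sup>2 + a\<^sup>2 - 2 * b * a * cos \<gamma>"
    using law_of_cosines_Gr[OF G(3,1,2) near near] assms(3-5,9)
    by (simp add: sym flip: c_def)
  have angles: "0 \<le> \<alpha>" "\<alpha> \<le> pi" "0 \<le> \<beta>" "\<beta> \<le> pi" "0 \<le> \<gamma>" "\<gamma> \<le> pi"
    using assms(7-9) by (simp_all add: angle_at_def vec_angle_bounds)
  have tri: "a \<le> b + c" "b \<le> a + c" "c \<le> a + b"
    using rdist_triangle[OF G(2,1,3)] rdist_triangle[OF G(1,2,3)] rdist_triangle[OF G(1,3,2)]
    by (simp_all add: sym flip: a_def b_def c_def)
  have "c \<ge> b * cos \<alpha> + a * cos \<beta>" and "\<alpha> + \<beta> + \<gamma> \<ge> pi" if "A \<noteq> B" "B \<noteq> C" "A \<noteq> C"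
  proof -
    have pos: "a > 0" "b > 0" "c > 0"
      using rdist_pos G that by (auto simp: a_def b_def c_def)
    \<comment> \<open>Adding the laws of cosines at \<open>A\<close> and \<open>B\<close> cancels
      the squares of \<open>a\<close> and \<open>b\<close> and leaves 2 c^2.\<close>
    have "2 * c * (b * cos \<alpha> + a * cos \<beta>) \<le> 2 * c * c"
      using cos_\<alpha> cos_\<beta> by (simp add: power2_eq_square algebra_simps)
    then show "c \<ge> b * cos \<alpha> + a * cos \<beta>"
      using pos(3) by simp
    show "\<alpha> + \<beta> + \<gamma> \<ge> pi"
      using angle_sum_ge_pi[OF pos tri angles cos_\<alpha> cos_\<beta>] cos_\<gamma> by (simp add: mult_ac add.commute)
  qed
  moreover have "(?d M C)\<^sup>2 \<ge> ((?d A C)\<^sup>2 + (?d B C)\<^sup>2) / 2 - (?d A B)\<^sup>2 / 4"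
    unfolding assms(6) by (rule semi_parallelogram_Gr[OF G near[OF assms(3,4)]])
  ultimately show ?thesis
    using cos_\<gamma> by (simp add: sym)
qed

end
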